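(* Assume that $\varphi$ is differentiable and strictly convex. If there exists some $\overline{\lambda}\in\mathbb{R}^{1+l}$ such that $$\int\varphi\left({\varphi'}^{-1}\left(\overline{\lambda}^Tg(x)\right)\right)dP(x)<\infty\quad\text{and}\quad\int g^T\,{\varphi'}^{-1}\left(\overline{\lambda}^Tg(x)\right)dP(x)=(1,0,\ldots,0)^T,\qquad(\ast)$$ then: (1) the measure $Q^*$ defined by $dQ^*(x)={\varphi'}^{-1}\left(\overline{\lambda}^Tg(x)\right)dP(x)$ is the unique $\phi$-projection of $P$ on $M_g$; (2) the equality $$\inf_{Q\in M_g}\phi(Q,P)=\sup_{\lambda\in\mathbb{R}^{1+l}}\left\{\lambda_0-\int_{\mathcal{X}}\varphi^*\left(\lambda^Tg(x)\right)dP(x)\right\}$$ holds, and $\overline{\lambda}$ is a dual optimal solution, i.e. it attains the supremum on the right-hand side. Furthermore, if the function $\varphi$ is essentially smooth, then the dual optimal solution $\overline{\lambda}$ is unique. In particular, $(\ast)$ holds if there exists a dual optimal solution $\overline{\lambda}$ which is an interior point of $$\left\{\lambda\in\mathbb{R}^{1+l}:\ \int_{\mathcal{X}}\left|\varphi^*\left(\lambda^Tg(x)\right)\right|dP(x)\text{ is finite}\right\}.$$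
   Context: $(\mathcal{X},\mathcal{B})$ is a measurable space and $P$ a given probability measure on it. $\mathcal{M}$ is the real vector space of all signed finite measures on $(\mathcal{X},\mathcal{B})$, and $\mathcal{M}(P)$ the subspace of those absolutely continuous w.r.t. $P$. The function $\varphi:\mathbb{R}\to[0,+\infty]$ is proper, convex and closed, with $\varphi(1)=0$, and its domain $\{x:\varphi(x)<\infty\}$ is an interval with endpoints $a_\varphi<1<b_\varphi$ (finite or infinite). Closed means that $\varphi(x)\to\varphi(a_\varphi)$ as $x\downarrow a_\varphi$ if $a_\varphi$ is finite, and $\varphi(x)\to\varphi(b_\varphi)$ as $x\uparrow b_\varphi$ if $b_\varphi$ is finite (equivalently, $\varphi$ is lower semi-continuous). "Differentiable" and "strictly convex" mean so on $]a_\varphi,b_\varphi[$; $\varphi'(a_\varphi)$ and $\varphi'(b_\varphi)$ denote the (finite or infinite) limits of $\varphi'(x)$ as $x\downarrow a_\varphi$ and $x\uparrow b_\varphi$; $\mathrm{Im}\,\varphi':=\{\varphi'(x):x\in[a_\varphi,b_\varphi]\}$. When $\varphi$ is differentiable and strictly convex, $\varphi'$ is one-to-one from $[a_\varphi,b_\varphi]$ to $\mathrm{Im}\,\varphi'$ and ${\varphi'}^{-1}:\mathrm{Im}\,\varphi'\to[a_\varphi,b_\varphi]$ is its inverse. $\varphi$ is essentially smooth if it is differentiable with $\varphi'(a_\varphi)=-\infty$ when $a_\varphi>-\infty$ and $\varphi'(b_\varphi)=+\infty$ when $b_\varphi<+\infty$. The conjugate is $\varphi^*(t):=\sup_{x\in\mathbb{R}}\{tx-\varphi(x)\}$.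 For $Q\in\mathcal{M}(P)$ put $\phi(Q,P):=\int_{\mathcal{X}}\varphi\left(\frac{dQ}{dP}\right)dP$, and $\phi(Q,P):=+\infty$ if $Q\in\mathcal{M}\setminus\mathcal{M}(P)$. For $\Omega\subseteq\mathcal{M}$ with $\inf_{Q\in\Omega}\phi(Q,P)<\infty$, a $\phi$-projection of $P$ on $\Omega$ is a measure $Q^*\in\Omega$ such that $\phi(Q^*,P)\le\phi(Q,P)$ for all $Q\in\Omega$. $g_1,\ldots,g_l:\mathcal{X}\to\mathbb{R}$ are measurable functions, $g_0:=\mathbf{1}_{\mathcal{X}}$, $g:=(g_0,g_1,\ldots,g_l)^T$, and $g_0,\ldots,g_l$ are linearly independent in the sense that $P\{\lambda^Tg(x)\ne0\}>0$ for every nonzero $\lambda=(\lambda_0,\ldots,\lambda_l)\in\mathbb{R}^{1+l}$. $M_g$ is the set of all $Q\in\mathcal{M}(P)$ which integrate the $g_i$ (i.e. $\int|g_i|\,d|Q|<\infty$) and satisfy $Q(\mathcal{X})=1$ and $\int_{\mathcal{X}}g_i\,dQ=0$ for $i=1,\ldots,l$.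
   Formalization: The inverse of φ' is extended outside Im φ' by the endpoints a_φ (below) and b_φ (above), and (∗) is read with this extension; with the inverse only on Im φ' the final "In particular" sentence fails when φ is not essentially smooth. *)

theory Defs
  imports "HOL-Probability.Probability_Measure"
begin

section \<open>Finite signed measures\<close>

text \<open>A finite signed measure on the measurable space underlying \<open>M\<close> is a countably additive
  real set function on \<open>sets M\<close>. It is set to 0 outside \<open>sets M\<close>, so that equality of
  functions is equality of signed measures. In the definitions below, only \<open>space M\<close> and
  \<open>sets M\<close> matter unless \<open>M\<close> is called \<open>P\<close>.\<close>

definition signed_measures :: "'a measure \<Rightarrow> ('a set \<Rightarrow> real) set" where
  "signed_measures M = {Q.
     Q {} = 0 \<and>
     (\<forall>A :: nat \<Rightarrow> 'a set. range A \<subseteq> sets M \<longrightarrow> disjoint_family A \<longrightarrow>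
        (\<lambda>i. Q (A i)) sums Q (\<Union>i. A i)) \<and>
     (\<forall>A. A \<notin> sets M \<longrightarrow> Q A = 0)}"

definition ac_signed_measures :: "'a measure \<Rightarrow> ('a set \<Rightarrow> real) set" where
  "ac_signed_measures P = {Q \<in> signed_measures P. \<forall>A \<in> null_sets P. Q A = 0}"

text \<open>Jordan decomposition and total variation. Negative reals are sent to 0 by \<^const>\<open>ennreal\<close>,
  which is harmless under the suprema because \<open>B = {}\<close> is admissible.\<close>

definition pos_variation :: "'a measure \<Rightarrow> ('a set \<Rightarrow> real) \<Rightarrow> 'a measure" where
  "pos_variation M Q =
     measure_of (space M) (sets M) (\<lambda>A. SUP B \<in> {B \<in> sets M. B \<subseteq> A}. ennreal (Q B))"

definition neg_variation :: "'a measure \<Rightarrow> ('a set \<Rightarrow> real) \<Rightarrow> 'a measure" where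
  "neg_variation M Q = pos_variation M (\<lambda>A. - Q A)"

definition total_variation :: "'a measure \<Rightarrow> ('a set \<Rightarrow> real) \<Rightarrow> 'a measure" where
  "total_variation M Q =
     measure_of (space M) (sets M)
       (\<lambda>A. emeasure (pos_variation M Q) A + emeasure (neg_variation M Q) A)"

definition signed_integral :: "'a measure \<Rightarrow> ('a set \<Rightarrow> real) \<Rightarrow> ('a \<Rightarrow> real) \<Rightarrow> real" where
  "signed_integral M Q f =
     (LINT x|pos_variation M Q. f x) - (LINT x|neg_variation M Q. f x)"

definition signed_density :: "'a measure \<Rightarrow> ('a \<Rightarrow> real) \<Rightarrow> 'a set \<Rightarrow> real" where
  "signed_density P f = (\<lambda>A. if A \<in> sets P then (LINT x:A|P. f x) else 0)"

definition signed_RN_deriv :: "'a measure \<Rightarrow> ('a set \<Rightarrow> real) \<Rightarrow> 'a \<Rightarrow> real" where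
  "signed_RN_deriv P Q = (SOME f. integrable P f \<and> Q = signed_density P f)"


section \<open>The function \<open>\<phi>\<close>\<close>

definition dom_lower :: "(real \<Rightarrow> ennreal) \<Rightarrow> ereal" where
  "dom_lower \<phi> = (INF x \<in> {x. \<phi> x < \<infinity>}. ereal x)"

definition dom_upper :: "(real \<Rightarrow> ennreal) \<Rightarrow> ereal" where
  "dom_upper \<phi> = (SUP x \<in> {x. \<phi> x < \<infinity>}. ereal x)"

definition convex_fun :: "(real \<Rightarrow> ennreal) \<Rightarrow> bool" where
  "convex_fun \<phi> \<longleftrightarrow> (\<forall>x y. \<forall>t \<in> {0..1}.
     \<phi> ((1 - t) * x + t * y) \<le> ennreal (1 - t) * \<phi> x + ennreal t * \<phi> y)"

definition closed_fun :: "(real \<Rightarrow> ennreal) \<Rightarrow> bool" where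
  "closed_fun \<phi> \<longleftrightarrow>
     (\<forall>a. dom_lower \<phi> = ereal a \<longrightarrow> (\<phi> \<longlongrightarrow> \<phi> a) (at_right a)) \<and>
     (\<forall>b. dom_upper \<phi> = ereal b \<longrightarrow> (\<phi> \<longlongrightarrow> \<phi> b) (at_left b))"

text \<open>Properness and the domain being an interval follow from \<open>\<phi> 1 = 0\<close> and convexity.\<close>

definition divergence_function :: "(real \<Rightarrow> ennreal) \<Rightarrow> bool" where
  "divergence_function \<phi> \<longleftrightarrow>
     convex_fun \<phi> \<and> closed_fun \<phi> \<and> \<phi> 1 = 0 \<and> dom_lower \<phi> < 1 \<and> 1 < dom_upper \<phi>"

definition differentiable_fun :: "(real \<Rightarrow> ennreal) \<Rightarrow> bool" where
  "differentiable_fun \<phi> \<longleftrightarrow> (\<forall>x. dom_lower \<phi> < ereal x \<and> ereal x < dom_upper \<phi> \<longrightarrow>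
     (\<lambda>y. enn2real (\<phi> y)) differentiable (at x))"

definition strictly_convex_fun :: "(real \<Rightarrow> ennreal) \<Rightarrow> bool" where
  "strictly_convex_fun \<phi> \<longleftrightarrow> (\<forall>x y. \<forall>t \<in> {0<..<1}.
     dom_lower \<phi> < ereal x \<and> ereal x < dom_upper \<phi> \<and>
     dom_lower \<phi> < ereal y \<and> ereal y < dom_upper \<phi> \<and> x \<noteq> y \<longrightarrow>
     \<phi> ((1 - t) * x + t * y) < ennreal (1 - t) * \<phi> x + ennreal t * \<phi> y)"

text \<open>The derivative of \<open>\<phi>\<close> lives on the closed interval \<open>{dom_lower \<phi>..dom_upper \<phi>}\<close> of extended
  reals; at its (finite or infinite) endpoints it is the one-sided limit.\<close>

definition phi_deriv :: "(real \<Rightarrow> ennreal) \<Rightarrow> ereal \<Rightarrow> ereal" where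
  "phi_deriv \<phi> x =
     (let D = (\<lambda>y. ereal (deriv (\<lambda>z. enn2real (\<phi> z)) (real_of_ereal y)))
      in if x = dom_lower \<phi> then Lim (at_right (dom_lower \<phi>)) D
         else if x = dom_upper \<phi> then Lim (at_left (dom_upper \<phi>)) D
         else D x)"

text \<open>The inverse of the derivative. Outside the image of \<^term>\<open>phi_deriv \<phi>\<close>, which is the interval
  from \<^term>\<open>phi_deriv \<phi> (dom_lower \<phi>)\<close> to \<^term>\<open>phi_deriv \<phi> (dom_upper \<phi>)\<close>, it is extended
  monotonically by the endpoint of the domain, i.e. by the point where \<open>t * x - \<phi> x\<close> is maximal.
  This matters when \<open>\<phi>\<close> is not essentially smooth: for
  \<open>\<phi> x = (x - 1)\<^sup>2\<close> on \<open>{0..}\<close> and \<open>\<infinity>\<close> elsewhere, the image is \<open>{-2..}\<close>, while \<open>t < -2\<close> lies in the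
  interior of the domain of the conjugate and is reached by optimal dual variables; the optimal
  density is then 0.\<close>

definition phi_deriv_inv :: "(real \<Rightarrow> ennreal) \<Rightarrow> ereal \<Rightarrow> ereal" where
  "phi_deriv_inv \<phi> t =
     (if t < phi_deriv \<phi> (dom_lower \<phi>) then dom_lower \<phi>
      else if phi_deriv \<phi> (dom_upper \<phi>) < t then dom_upper \<phi>
      else the_inv_into {dom_lower \<phi>..dom_upper \<phi>} (phi_deriv \<phi>) t)"

definition essentially_smooth :: "(real \<Rightarrow> ennreal) \<Rightarrow> bool" where
  "essentially_smooth \<phi> \<longleftrightarrow> differentiable_fun \<phi> \<and>
     (dom_lower \<phi> > - \<infinity> \<longrightarrow> phi_deriv \<phi> (dom_lower \<phi>) = - \<infinity>) \<and>
     (dom_upper \<phi> < \<infinity> \<longrightarrow> phi_deriv \<phi> (dom_upper \<phi>) = \<infinity>)"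

definition conjugate :: "(real \<Rightarrow> ennreal) \<Rightarrow> real \<Rightarrow> ereal" where
  "conjugate \<phi> t = (SUP x. ereal (t * x) - enn2ereal (\<phi> x))"


section \<open>Divergences and projections\<close>

definition divergence :: "(real \<Rightarrow> ennreal) \<Rightarrow> 'a measure \<Rightarrow> ('a set \<Rightarrow> real) \<Rightarrow> ennreal" where
  "divergence \<phi> P Q =
     (if Q \<in> ac_signed_measures P then (\<integral>\<^sup>+ x. \<phi> (signed_RN_deriv P Q x) \<partial>P) else \<infinity>)"

definition is_projection ::
  "(real \<Rightarrow> ennreal) \<Rightarrow> 'a measure \<Rightarrow> ('a set \<Rightarrow> real) set \<Rightarrow> ('a set \<Rightarrow> real) \<Rightarrow> bool" where
  "is_projection \<phi> P \<Omega> Q \<longleftrightarrow>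
     (INF R \<in> \<Omega>. divergence \<phi> P R) < \<infinity> \<and>
     Q \<in> \<Omega> \<and> (\<forall>R \<in> \<Omega>. divergence \<phi> P Q \<le> divergence \<phi> P R)"


section \<open>Linear constraints and the dual problem\<close>

text \<open>The index type \<open>'l\<close> stands for \<open>{1..l}\<close>, and \<open>\<real>\<^sup>1\<^sup>+\<^sup>l\<close> is \<^typ>\<open>real \<times> (real ^ 'l)\<close>, the first
  component being the one with index 0. So \<^term>\<open>gvec g x\<close> is the vector with entries
  \<open>g\<^sub>0 x = 1, g\<^sub>1 x, \<dots>, g\<^sub>l x\<close>.\<close>

definition gvec :: "('l::finite \<Rightarrow> 'a \<Rightarrow> real) \<Rightarrow> 'a \<Rightarrow> real \<times> (real ^ 'l)" where
  "gvec g x = (1, \<chi> i. g i x)"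

definition lin_indep :: "'a measure \<Rightarrow> ('l::finite \<Rightarrow> 'a \<Rightarrow> real) \<Rightarrow> bool" where
  "lin_indep P g \<longleftrightarrow>
     (\<forall>v. v \<noteq> 0 \<longrightarrow> measure P {x \<in> space P. inner v (gvec g x) \<noteq> 0} > 0)"

text \<open>The constant function with index 0 is integrable with respect to every finite signed measure.\<close>

definition constraint_set :: "'a measure \<Rightarrow> ('l::finite \<Rightarrow> 'a \<Rightarrow> real) \<Rightarrow> ('a set \<Rightarrow> real) set" where
  "constraint_set P g = {Q \<in> ac_signed_measures P.
     (\<forall>i. integrable (total_variation P Q) (g i)) \<and>
     Q (space P) = 1 \<and>
     (\<forall>i. signed_integral P Q (g i) = 0)}"

text \<open>Integral of an extended-real function. As \<open>\<infinity> - \<infinity> = \<infinity>\<close> in \<^typ>\<open>ereal\<close>, the integral is \<open>\<infinity>\<close>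
  when the positive part has infinite integral. Thus in the dual problem, vectors \<open>v\<close> for which
  the integral is undefined have objective value \<open>- \<infinity>\<close> and do not affect the supremum.\<close>

definition ext_integral :: "'a measure \<Rightarrow> ('a \<Rightarrow> ereal) \<Rightarrow> ereal" where
  "ext_integral P f =
     enn2ereal (\<integral>\<^sup>+ x. e2ennreal (f x) \<partial>P) - enn2ereal (\<integral>\<^sup>+ x. e2ennreal (- f x) \<partial>P)"

definition dual_objective ::
  "(real \<Rightarrow> ennreal) \<Rightarrow> 'a measure \<Rightarrow> ('l::finite \<Rightarrow> 'a \<Rightarrow> real) \<Rightarrow> real \<times> (real ^ 'l) \<Rightarrow> ereal" where
  "dual_objective \<phi> P g v =
     ereal (fst v) - ext_integral P (\<lambda>x. conjugate \<phi> (inner v (gvec g x)))"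

definition dual_optimal ::
  "(real \<Rightarrow> ennreal) \<Rightarrow> 'a measure \<Rightarrow> ('l::finite \<Rightarrow> 'a \<Rightarrow> real) \<Rightarrow> real \<times> (real ^ 'l) \<Rightarrow> bool" where
  "dual_optimal \<phi> P g v \<longleftrightarrow> dual_objective \<phi> P g v = (SUP w. dual_objective \<phi> P g w)"

definition conj_integrable_set ::
  "(real \<Rightarrow> ennreal) \<Rightarrow> 'a measure \<Rightarrow> ('l::finite \<Rightarrow> 'a \<Rightarrow> real) \<Rightarrow> (real \<times> (real ^ 'l)) set" where
  "conj_integrable_set \<phi> P g =
     {v. (\<integral>\<^sup>+ x. e2ennreal \<bar>conjugate \<phi> (inner v (gvec g x))\<bar> \<partial>P) < \<infinity>}"

definition dual_density_ext ::
  "(real \<Rightarrow> ennreal) \<Rightarrow> ('l::finite \<Rightarrow> 'a \<Rightarrow> real) \<Rightarrow> real \<times> (real ^ 'l) \<Rightarrow> 'a \<Rightarrow> ereal" where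
  "dual_density_ext \<phi> g v x = phi_deriv_inv \<phi> (ereal (inner v (gvec g x)))"

definition dual_density ::
  "(real \<Rightarrow> ennreal) \<Rightarrow> ('l::finite \<Rightarrow> 'a \<Rightarrow> real) \<Rightarrow> real \<times> (real ^ 'l) \<Rightarrow> 'a \<Rightarrow> real" where
  "dual_density \<phi> g v x = real_of_ereal (dual_density_ext \<phi> g v x)"

text \<open>The condition \<open>(\<ast>)\<close>. The almost sure finiteness in the first clause is implicit in the
  existence of the integrals of an extended-real function; it is needed because
  \<^const>\<open>real_of_ereal\<close> sends infinite values to 0.\<close>

definition moment_condition ::
  "(real \<Rightarrow> ennreal) \<Rightarrow> 'a measure \<Rightarrow> ('l::finite \<Rightarrow> 'a \<Rightarrow> real) \<Rightarrow> real \<times> (real ^ 'l) \<Rightarrow> bool" where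
  "moment_condition \<phi> P g v \<longleftrightarrow>
     (AE x in P. \<bar>dual_density_ext \<phi> g v x\<bar> \<noteq> \<infinity>) \<and>
     (\<integral>\<^sup>+ x. \<phi> (dual_density \<phi> g v x) \<partial>P) < \<infinity> \<and>
     integrable P (\<lambda>x. dual_density \<phi> g v x *\<^sub>R gvec g x) \<and>
     (LINT x|P. dual_density \<phi> g v x *\<^sub>R gvec g x) = (1, 0)"

end

theory Submission
  imports Defs
begin

text \<open>
  Everything follows from one pointwise fact, the Young inequality
  \<open>t p - \<phi> p \<le> \<phi>\<^sup>* t\<close> together with its equality case: for a finite \<open>p\<close>, equality holds
  exactly when \<open>p\<close> is the value \<open>\<psi> t\<close> of the (monotonically extended) inverse derivative
  at \<open>t\<close>. This is \<open>psi_eq_iff\<close>.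

  Let \<open>h\<close> be the density of an admissible signed measure of finite divergence. The linear
  constraints say that \<open>h (\<lambda>\<^sup>T g)\<close> has integral \<open>\<lambda>\<^sub>0\<close> for every \<open>\<lambda>\<close>. Integrating the Young
  inequality at \<open>t = \<lambda>\<^sup>T g x\<close> and \<open>p = h x\<close> therefore bounds the dual objective at \<open>\<lambda>\<close> by the
  divergence of \<open>h\<close> (\<open>weak_duality\<close>), and there is no gap between the two numbers if and only if
  \<open>h = \<psi> (\<lambda>\<^sup>T g)\<close> almost everywhere (\<open>no_duality_gap_iff\<close>). This equivalence is used three times.
  The density given by the moment condition at \<open>v\<close> has no gap with \<open>v\<close>, so both are optimal and
  the optimal values agree. Another projection has the same divergence, hence no gap with \<open>v\<close>,
  hence the same density. Another dual optimum \<open>w\<close> has no gap with the density, so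
  \<open>\<psi> (w\<^sup>T g) = \<psi> (v\<^sup>T g)\<close> almost everywhere; essential smoothness keeps the values of \<open>\<psi>\<close> inside
  the open domain, where \<open>\<psi>\<close> is injective, and linear independence gives \<open>w = v\<close>.

  The last claim is the first-order condition for the concave dual objective
  (\<open>directional_first_order_condition\<close>). The derivative of \<open>\<phi>\<^sup>*\<close> is \<open>\<psi>\<close>. Near an interior optimum
  the difference quotients of \<open>\<phi>\<^sup>* (\<lambda>\<^sup>T g)\<close> in a direction \<open>u\<close> are dominated, because they are
  monotone in the step width, and they converge to \<open>\<psi> (v\<^sup>T g) (u\<^sup>T g)\<close>. Optimality along \<open>u\<close> and
  \<open>- u\<close> yields exactly the moment equations.

  Two preparations are needed. A signed measure that is absolutely continuous has a density, which
  is obtained from the Jordan decomposition and the Radon-Nikodym theorem for finite measures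
  (\<open>signed_Radon_Nikodym\<close>); conversely the variations of a measure with density \<open>f\<close> have the
  positive and negative parts of \<open>f\<close> as densities. On the side of convex analysis, \<open>\<psi> t\<close> is
  described as the point where \<open>\<phi>'\<close> crosses the level \<open>t\<close> (\<open>psi_crossing\<close>); this treats finite
  and infinite endpoints of the domain alike and gives the equality case as well as the continuity
  of \<open>\<psi>\<close>.
\<close>

section \<open>Radon-Nikodym for finite signed measures\<close>

text \<open>The set function that generates \<^const>\<open>pos_variation\<close>. It has to be shown countably additive
  before anything can be said about the measure.\<close>
definition sup_charge :: "'a measure \<Rightarrow> ('a set \<Rightarrow> real) \<Rightarrow> 'a set \<Rightarrow> ennreal" where
  "sup_charge M Q A = (SUP B \<in> {B \<in> sets M. B \<subseteq> A}. ennreal (Q B))"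

lemma sup_charge_upper: "B \<in> sets M \<Longrightarrow> B \<subseteq> A \<Longrightarrow> ennreal (Q B) \<le> sup_charge M Q A"
  unfolding sup_charge_def by (rule SUP_upper) auto

lemma sup_charge_least:
  "(\<And>B. B \<in> sets M \<Longrightarrow> B \<subseteq> A \<Longrightarrow> ennreal (Q B) \<le> c) \<Longrightarrow> sup_charge M Q A \<le> c"
  unfolding sup_charge_def by (rule SUP_least) auto

lemma ennreal_add_le: "ennreal (a + b) \<le> ennreal a + ennreal b"
proof -
  have "ennreal (a + b) \<le> ennreal (max 0 a + max 0 b)" by (rule ennreal_leI) auto
  also have "\<dots> = ennreal (max 0 a) + ennreal (max 0 b)" by (rule ennreal_plus) auto
  finally show ?thesis by (simp add: max_def ennreal_neg split: if_splits)
qed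

lemma signed_measures_empty: "Q \<in> signed_measures M \<Longrightarrow> Q {} = 0"
  by (simp add: signed_measures_def)

lemma signed_measures_sums:
  "Q \<in> signed_measures M \<Longrightarrow> range A \<subseteq> sets M \<Longrightarrow> disjoint_family (A :: nat \<Rightarrow> _) \<Longrightarrow>
    (\<lambda>i. Q (A i)) sums Q (\<Union>i. A i)"
  by (simp add: signed_measures_def)

lemma signed_measures_uminus: "Q \<in> signed_measures M \<Longrightarrow> (\<lambda>A. - Q A) \<in> signed_measures M"
  by (auto simp: signed_measures_def intro: sums_minus)

lemma signed_measures_Un:
  assumes "Q \<in> signed_measures M" "A \<in> sets M" "B \<in> sets M" "A \<inter> B = {}"
  shows "Q (A \<union> B) = Q A + Q B"
proof -
  have "disjoint_family (binaryset A B)"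
    using assms(4) by (auto simp: disjoint_family_on_def binaryset_def)
  then have "(\<lambda>i. Q (binaryset A B i)) sums Q (A \<union> B)"
    using signed_measures_sums[OF assms(1), of "binaryset A B"] assms(2,3)
    by (simp add: range_binaryset_eq UN_binaryset_eq)
  moreover have "(\<lambda>i. Q (binaryset A B i)) sums (Q A + Q B)"
    by (rule binaryset_sums) (rule signed_measures_empty[OF assms(1)])
  ultimately show ?thesis by (rule sums_unique2)
qed

lemma signed_measures_Diff:
  assumes "Q \<in> signed_measures M" "A \<in> sets M" "B \<in> sets M" "B \<subseteq> A"
  shows "Q (A - B) = Q A - Q B"
proof -
  have "A = (A - B) \<union> B" using assms(4) by auto
  then have "Q A = Q (A - B) + Q B"
    using signed_measures_Un[OF assms(1), of "A - B" B] assms(2,3) by (metis Diff_disjoint inf_commute sets.Diff)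
  then show ?thesis by simp
qed

lemma sup_charge_subadditive:
  assumes Q: "Q \<in> signed_measures M" and "A \<in> sets M" "B \<in> sets M" "B \<subseteq> A"
  shows "sup_charge M Q A \<le> sup_charge M Q B + sup_charge M Q (A - B)"
proof (rule sup_charge_least)
  fix C assume C: "C \<in> sets M" "C \<subseteq> A"
  have "Q C = Q (C \<inter> B) + Q (C - B)"
    using signed_measures_Un[OF Q, of "C \<inter> B" "C - B"] C assms
    by (metis Int_Diff Int_Diff_Un sets.Diff sets.Int Int_Diff_disjoint)
  then have "ennreal (Q C) \<le> ennreal (Q (C \<inter> B)) + ennreal (Q (C - B))"
    using ennreal_add_le by metis
  also have "\<dots> \<le> sup_charge M Q B + sup_charge M Q (A - B)"
    using C assms by (intro add_mono sup_charge_upper) auto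
  finally show "ennreal (Q C) \<le> sup_charge M Q B + sup_charge M Q (A - B)" .
qed

text \<open>Near-optimal subsets of \<open>A\<close> and of \<open>B\<close> can be united. Those of negative charge are replaced by the
  empty set, since \<^const>\<open>ennreal\<close> is additive only on nonnegative reals.\<close>
lemma sup_charge_superadditive:
  assumes Q: "Q \<in> signed_measures M" and "A \<inter> B = {}"
  shows "sup_charge M Q A + sup_charge M Q B \<le> sup_charge M Q (A \<union> B)"
proof -
  have key: "ennreal (Q C) + ennreal (Q D) \<le> sup_charge M Q (A \<union> B)"
    if CD: "C \<in> sets M" "C \<subseteq> A" "D \<in> sets M" "D \<subseteq> B" for C D
  proof -
    define C' where "C' = (if Q C \<ge> 0 then C else {})"
    define D' where "D' = (if Q D \<ge> 0 then D else {})"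
    have *: "C' \<in> sets M" "C' \<subseteq> A" "D' \<in> sets M" "D' \<subseteq> B" "Q C' \<ge> 0" "Q D' \<ge> 0"
      using CD signed_measures_empty[OF Q] by (auto simp: C'_def D'_def)
    have "ennreal (Q C) + ennreal (Q D) = ennreal (Q C') + ennreal (Q D')"
      using signed_measures_empty[OF Q] by (auto simp: C'_def D'_def ennreal_neg)
    also have "\<dots> = ennreal (Q C' + Q D')"
      using * by (simp add: ennreal_plus)
    also have "\<dots> = ennreal (Q (C' \<union> D'))"
      using * assms(2) by (subst signed_measures_Un[OF Q]) auto
    also have "\<dots> \<le> sup_charge M Q (A \<union> B)"
      using * by (intro sup_charge_upper) auto
    finally show ?thesis .
  qed
  have "sup_charge M Q A + ennreal (Q D) \<le> sup_charge M Q (A \<union> B)"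
    if D: "D \<in> sets M" "D \<subseteq> B" for D
    unfolding sup_charge_def[of M Q A]
    using key D by (subst ennreal_SUP_add_left[symmetric]) (auto intro!: SUP_least)
  then show ?thesis
    unfolding sup_charge_def[of M Q B]
    by (subst ennreal_SUP_add_right) (auto intro!: SUP_least)
qed

lemma countably_additive_sup_charge:
  assumes Q: "Q \<in> signed_measures M"
  shows "countably_additive (sets M) (sup_charge M Q)"
proof (rule countably_additiveI)
  fix A :: "nat \<Rightarrow> 'a set"
  assume A: "range A \<subseteq> sets M" "disjoint_family A" "(\<Union>i. A i) \<in> sets M"
  show "(\<Sum>i. sup_charge M Q (A i)) = sup_charge M Q (\<Union>i. A i)"
  proof (rule antisym)
    have fin: "(\<Sum>i<n. sup_charge M Q (A i)) \<le> sup_charge M Q (\<Union>i<n. A i)" for n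
    proof (induction n)
      case (Suc n)
      have "A i \<inter> A n = {}" if "i < n" for i
        using disjoint_family_onD[OF A(2), of i n] that by simp
      then have "(\<Union>i<n. A i) \<inter> A n = {}" by blast
      note sup_charge_superadditive[OF Q this]
      moreover have "(\<Sum>i<Suc n. sup_charge M Q (A i)) \<le> sup_charge M Q (\<Union>i<n. A i) + sup_charge M Q (A n)"
        using add_right_mono[OF Suc] by simp
      ultimately have "(\<Sum>i<Suc n. sup_charge M Q (A i)) \<le> sup_charge M Q ((\<Union>i<n. A i) \<union> A n)"
        by (rule order_trans[rotated])
      then show ?case by (simp add: lessThan_Suc Un_commute)
    qed simp
    have "sup_charge M Q (\<Union>i<n. A i) \<le> sup_charge M Q (\<Union>i. A i)" for n
      by (intro sup_charge_least sup_charge_upper) auto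
    then have "(\<Sum>i<n. sup_charge M Q (A i)) \<le> sup_charge M Q (\<Union>i. A i)" for n
      by (rule order_trans[OF fin])
    then show "(\<Sum>i. sup_charge M Q (A i)) \<le> sup_charge M Q (\<Union>i. A i)"
      by (intro suminf_le_const summableI)
  next
    show "sup_charge M Q (\<Union>i. A i) \<le> (\<Sum>i. sup_charge M Q (A i))"
    proof (rule sup_charge_least)
      fix C assume C: "C \<in> sets M" "C \<subseteq> (\<Union>i. A i)"
      have "(\<lambda>i. Q (C \<inter> A i)) sums Q (\<Union>i. C \<inter> A i)"
        using A C by (intro signed_measures_sums[OF Q]) (auto simp: disjoint_family_on_def)
      also have "(\<Union>i. C \<inter> A i) = C" using C by auto
      finally have "(\<lambda>n. ennreal (\<Sum>i<n. Q (C \<inter> A i))) \<longlonglongrightarrow> ennreal (Q C)"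
        unfolding sums_def by (rule tendsto_ennrealI)
      moreover have "ennreal (\<Sum>i<n. Q (C \<inter> A i)) \<le> (\<Sum>i. sup_charge M Q (A i))" for n
      proof -
        have "ennreal (\<Sum>i<n. Q (C \<inter> A i)) \<le> (\<Sum>i<n. ennreal (Q (C \<inter> A i)))"
        proof (induction n)
          case (Suc n)
          show ?case
            using order_trans[OF ennreal_add_le add_right_mono[OF Suc]] by simp
        qed simp
        also have "\<dots> \<le> (\<Sum>i<n. sup_charge M Q (A i))"
          using A C by (intro sum_mono sup_charge_upper) auto
        also have "\<dots> \<le> (\<Sum>i. sup_charge M Q (A i))"
          by (rule sum_le_suminf) auto
        finally show ?thesis .
      qed
      ultimately show "ennreal (Q C) \<le> (\<Sum>i. sup_charge M Q (A i))"
        using LIMSEQ_le_const2 by blast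
    qed
  qed
qed

lemma emeasure_pos_variation:
  assumes Q: "Q \<in> signed_measures M" and "A \<in> sets M"
  shows "emeasure (pos_variation M Q) A = sup_charge M Q A"
proof -
  have "positive (sets M) (sup_charge M Q)"
    using signed_measures_empty[OF Q] by (auto simp: positive_def sup_charge_def)
  then show ?thesis
    unfolding pos_variation_def sup_charge_def[symmetric]
    using countably_additive_sup_charge[OF Q] assms(2) sets.sigma_algebra_axioms
    by (intro emeasure_measure_of_sigma) auto
qed

lemma sets_pos_variation [simp]: "sets (pos_variation M Q) = sets M"
  and space_pos_variation [simp]: "space (pos_variation M Q) = space M"
  unfolding pos_variation_def by simp_all

text \<open>If the supremum were infinite, one could choose a decreasing sequence of sets, each of
  infinite positive variation, along which the charge is unbounded: a subset \<open>B\<close> of large charge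
  and its complement both have large absolute charge, and one of them still has infinite variation.
  But the charges of a decreasing sequence converge.\<close>
lemma sup_charge_finite:
  assumes Q: "Q \<in> signed_measures M"
  shows "sup_charge M Q (space M) < \<infinity>"
proof (rule ccontr)
  assume "\<not> ?thesis"
  then have inf: "sup_charge M Q (space M) = \<infinity>" by (simp add: not_less top_unique)
  define G where "G n E \<longleftrightarrow> E \<in> sets M \<and> sup_charge M Q E = \<infinity> \<and> real n \<le> \<bar>Q E\<bar>" for n :: nat and E
  have "\<exists>E. \<forall>n. G n (E n) \<and> E (Suc n) \<subseteq> E n"
  proof (rule dependent_nat_choice)
    show "\<exists>E. G 0 E" using inf by (auto simp: G_def)
  next
    fix E n assume E: "G n E"
    then have "ennreal (\<bar>Q E\<bar> + real (Suc n)) < sup_charge M Q E"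
      by (simp add: G_def)
    then obtain B where B: "B \<in> sets M" "B \<subseteq> E"
      "ennreal (\<bar>Q E\<bar> + real (Suc n)) < ennreal (Q B)"
      unfolding sup_charge_def less_SUP_iff by auto
    then have big: "\<bar>Q E\<bar> + real (Suc n) < Q B"
      by (metis abs_ge_zero add_nonneg_nonneg ennreal_less_iff of_nat_0_le_iff)
    have "Q (E - B) = Q E - Q B"
      using E B by (intro signed_measures_Diff[OF Q]) (auto simp: G_def)
    moreover have "sup_charge M Q B = \<infinity> \<or> sup_charge M Q (E - B) = \<infinity>"
      using sup_charge_subadditive[OF Q, of E B] E B
      by (auto simp: G_def top_unique)
    ultimately have "G (Suc n) B \<or> G (Suc n) (E - B)"
      using E B big unfolding G_def by auto
    then show "\<exists>F. G (Suc n) F \<and> F \<subseteq> E" using B by auto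
  qed
  then obtain E where E: "\<And>n. G n (E n)" "\<And>n. E (Suc n) \<subseteq> E n" by auto
  have sets: "E n \<in> sets M" for n using E(1)[of n] by (simp add: G_def)
  have "disjoint_family (\<lambda>i. - E (Suc i) - - E i)"
    using E(2) by (intro disjoint_family_Suc) auto
  then have "disjoint_family (\<lambda>i. E i - E (Suc i))"
    by (rule disjoint_family_on_bisimulation) auto
  then have "(\<lambda>i. Q (E i - E (Suc i))) sums Q (\<Union>i. E i - E (Suc i))"
    using sets by (intro signed_measures_sums[OF Q]) auto
  also have "(\<lambda>i. Q (E i - E (Suc i))) = (\<lambda>i. Q (E i) - Q (E (Suc i)))"
    using sets E(2) by (intro ext signed_measures_Diff[OF Q]) auto
  finally have "convergent (\<lambda>n. \<Sum>i<n. Q (E i) - Q (E (Suc i)))"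
    by (auto simp: sums_def convergent_def)
  also have "(\<lambda>n. \<Sum>i<n. Q (E i) - Q (E (Suc i))) = (\<lambda>n. Q (E 0) - Q (E n))"
    by (intro ext) (rule sum_lessThan_telescope')
  finally have "Bseq (\<lambda>n. Q (E 0) - Q (E n))" by (rule convergent_imp_Bseq)
  then obtain K where K: "\<And>n. \<bar>Q (E 0) - Q (E n)\<bar> \<le> K" by (auto simp: Bseq_def)
  obtain n where n: "real n > K + \<bar>Q (E 0)\<bar>" using reals_Archimedean2 by auto
  have "real n \<le> \<bar>Q (E n)\<bar>" using E(1)[of n] by (simp add: G_def)
  with K[of n] n show False by linarith
qed

lemma finite_measure_pos_variation:
  assumes Q: "Q \<in> signed_measures M"
  shows "finite_measure (pos_variation M Q)"
  using sup_charge_finite[OF Q] emeasure_pos_variation[OF Q, of "space M"]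
  by (intro finite_measureI) auto

lemma jordan_decomposition:
  assumes Q: "Q \<in> signed_measures M" and A: "A \<in> sets M"
  shows "Q A = measure (pos_variation M Q) A - measure (neg_variation M Q) A"
proof -
  have Q': "(\<lambda>A. - Q A) \<in> signed_measures M" by (rule signed_measures_uminus[OF Q])
  interpret p: finite_measure "pos_variation M Q" by (rule finite_measure_pos_variation[OF Q])
  interpret n: finite_measure "neg_variation M Q"
    unfolding neg_variation_def by (rule finite_measure_pos_variation[OF Q'])
  have ep: "ennreal (measure (pos_variation M Q) B) = sup_charge M Q B" if "B \<in> sets M" for B
    using that p.emeasure_eq_measure[of B] emeasure_pos_variation[OF Q] by simp
  have en: "ennreal (measure (neg_variation M Q) B) = sup_charge M (\<lambda>A. - Q A) B" if "B \<in> sets M" for B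
    using that n.emeasure_eq_measure[of B] emeasure_pos_variation[OF Q']
    unfolding neg_variation_def by simp
  \<comment> \<open>Both inequalities come from passing from \<open>B \<subseteq> A\<close> to \<open>A - B\<close>.\<close>
  have "sup_charge M Q A \<le> ennreal (measure (neg_variation M Q) A + Q A)"
  proof (rule sup_charge_least)
    fix B assume B: "B \<in> sets M" "B \<subseteq> A"
    have "ennreal (- Q (A - B)) \<le> ennreal (measure (neg_variation M Q) A)"
      using A B unfolding en[OF A] by (intro sup_charge_upper[where Q = "\<lambda>A. - Q A"]) auto
    then have "- Q (A - B) \<le> measure (neg_variation M Q) A"
      by (metis ennreal_le_iff measure_nonneg)
    then show "ennreal (Q B) \<le> ennreal (measure (neg_variation M Q) A + Q A)"
      using signed_measures_Diff[OF Q A B] by (intro ennreal_leI) simp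
  qed
  moreover have "sup_charge M (\<lambda>A. - Q A) A \<le> ennreal (measure (pos_variation M Q) A - Q A)"
  proof (rule sup_charge_least)
    fix B assume B: "B \<in> sets M" "B \<subseteq> A"
    have "ennreal (Q (A - B)) \<le> ennreal (measure (pos_variation M Q) A)"
      using A B unfolding ep[OF A] by (intro sup_charge_upper) auto
    then have "Q (A - B) \<le> measure (pos_variation M Q) A"
      by (metis ennreal_le_iff measure_nonneg)
    then show "ennreal (- Q B) \<le> ennreal (measure (pos_variation M Q) A - Q A)"
      using signed_measures_Diff[OF Q A B] by (intro ennreal_leI) simp
  qed
  moreover have "Q A \<le> measure (pos_variation M Q) A"
    using sup_charge_upper[of A M A Q] A unfolding ep[OF A, symmetric]
    by (metis ennreal_le_iff measure_nonneg order_refl)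
  moreover have "- Q A \<le> measure (neg_variation M Q) A"
    using sup_charge_upper[of A M A "\<lambda>A. - Q A"] A unfolding en[OF A, symmetric]
    by (metis ennreal_le_iff measure_nonneg order_refl)
  ultimately show ?thesis
    unfolding ep[OF A, symmetric] en[OF A, symmetric] by (simp add: ennreal_le_iff)
qed

lemma absolutely_continuous_pos_variation:
  assumes Q: "Q \<in> ac_signed_measures P"
  shows "absolutely_continuous P (pos_variation P Q)"
proof -
  have "sup_charge P Q A = 0" if "A \<in> null_sets P" for A
  proof -
    have "ennreal (Q B) = 0" if "B \<in> sets P" "B \<subseteq> A" for B
    proof -
      have "B \<in> null_sets P" by (rule null_sets_subset) fact+
      then show ?thesis using Q by (simp add: ac_signed_measures_def)
    qed
    then show ?thesis using sup_charge_least[of P A Q 0] by simp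
  qed
  moreover have "Q \<in> signed_measures P" using Q by (simp add: ac_signed_measures_def)
  ultimately show ?thesis
    unfolding absolutely_continuous_def
    by (intro subsetI null_setsI) (simp_all add: emeasure_pos_variation null_setsD2)
qed

text \<open>As the positive variation is a finite measure, its Radon-Nikodym derivative is almost everywhere
  finite and can be replaced by an integrable real function.\<close>
lemma (in finite_measure) pos_variation_density:
  assumes Q: "Q \<in> ac_signed_measures M"
  obtains f where "integrable M f" "\<And>A. A \<in> sets M \<Longrightarrow> measure (pos_variation M Q) A = (LINT x:A|M. f x)"
proof -
  have Q': "Q \<in> signed_measures M" using Q by (simp add: ac_signed_measures_def)
  let ?N = "pos_variation M Q"
  interpret N: finite_measure ?N by (rule finite_measure_pos_variation[OF Q'])
  obtain D where D: "D \<in> borel_measurable M" "AE x in M. RN_deriv M ?N x = ennreal (D x)" "\<And>x. 0 \<le> D x"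
    by (rule real_RN_deriv[OF finite_measure_pos_variation[OF Q'] absolutely_continuous_pos_variation[OF Q] sets_pos_variation])
      blast
  have em: "emeasure ?N A = (\<integral>\<^sup>+x. ennreal (indicator A x * D x) \<partial>M)" if "A \<in> sets M" for A
  proof -
    have "emeasure ?N A = emeasure (density M (RN_deriv M ?N)) A"
      using density_RN_deriv[OF absolutely_continuous_pos_variation[OF Q] sets_pos_variation] by simp
    also have "\<dots> = (\<integral>\<^sup>+x. RN_deriv M ?N x * indicator A x \<partial>M)"
      using that by (simp add: emeasure_density)
    also have "\<dots> = (\<integral>\<^sup>+x. ennreal (indicator A x * D x) \<partial>M)"
      using D(2) by (intro nn_integral_cong_AE) (auto simp: indicator_def)
    finally show ?thesis .
  qed
  have "integrable M D"
    using em[of "space M"] N.emeasure_finite[of "space M"] D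
    by (intro integrableI_nonneg) (auto simp: less_top cong: nn_integral_cong)
  moreover have "measure ?N A = (LINT x:A|M. D x)" if "A \<in> sets M" for A
    unfolding measure_def em[OF that] set_lebesgue_integral_def
    using D that by (subst integral_eq_nn_integral) auto
  ultimately show ?thesis using that by blast
qed

lemma set_integrable_of_integrable:
  fixes f :: "'a \<Rightarrow> real"
  shows "integrable M f \<Longrightarrow> A \<in> sets M \<Longrightarrow> set_integrable M A f"
  unfolding set_integrable_def by (rule integrable_mult_indicator)

lemma (in finite_measure) signed_Radon_Nikodym:
  assumes Q: "Q \<in> ac_signed_measures M"
  shows "\<exists>f. integrable M f \<and> Q = signed_density M f"
proof -
  have Q': "Q \<in> signed_measures M" using Q by (simp add: ac_signed_measures_def)
  have mQ: "(\<lambda>A. - Q A) \<in> ac_signed_measures M"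
    using Q signed_measures_uminus by (auto simp: ac_signed_measures_def)
  obtain f where f: "integrable M f" "\<And>A. A \<in> sets M \<Longrightarrow> measure (pos_variation M Q) A = (LINT x:A|M. f x)"
    using pos_variation_density[OF Q] by blast
  obtain h where h: "integrable M h" "\<And>A. A \<in> sets M \<Longrightarrow> measure (neg_variation M Q) A = (LINT x:A|M. h x)"
    using pos_variation_density[OF mQ] unfolding neg_variation_def by blast
  have "Q A = signed_density M (\<lambda>x. f x - h x) A" for A
  proof (cases "A \<in> sets M")
    case True
    then have "set_integrable M A f" "set_integrable M A h"
      using f h by (auto intro: set_integrable_of_integrable)
    with True jordan_decomposition[OF Q' True] f h show ?thesis
      by (simp add: signed_density_def set_integral_diff)
  next
    case False
    with Q' show ?thesis by (simp add: signed_density_def signed_measures_def)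
  qed
  then show ?thesis using f(1) h(1) by (intro exI[of _ "\<lambda>x. f x - h x"]) auto
qed

lemma signed_density_AE_unique:
  assumes "integrable P f" "integrable P h" "signed_density P f = signed_density P h"
  shows "AE x in P. f x = h x"
proof (rule density_unique_real[OF assms(1,2)])
  fix A assume "A \<in> sets P"
  then show "(LINT x:A|P. f x) = (LINT x:A|P. h x)"
    using fun_cong[OF assms(3), of A] by (simp add: signed_density_def)
qed

lemma signed_density_cong_AE:
  assumes "f \<in> borel_measurable P" "h \<in> borel_measurable P" "AE x in P. f x = h x"
  shows "signed_density P f = signed_density P h"
  unfolding signed_density_def set_lebesgue_integral_def
  using assms by (intro ext if_cong integral_cong_AE) (auto intro: borel_measurable_indicator)

lemma signed_density_ac:
  assumes f: "integrable P f"
  shows "signed_density P f \<in> ac_signed_measures P"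
proof -
  have "(\<lambda>i. signed_density P f (A i)) sums signed_density P f (\<Union>i. A i)"
    if A: "range A \<subseteq> sets P" "disjoint_family A" for A :: "nat \<Rightarrow> _"
  proof -
    have int: "set_integrable P B f" if "B \<in> sets P" for B
      using f that by (rule set_integrable_of_integrable)
    have "(\<lambda>n. LINT x:(\<Union>i<n. A i)|P. f x) \<longlonglongrightarrow> (LINT x:(\<Union>n. \<Union>i<n. A i)|P. f x)"
      using A by (intro set_integral_cont_up int) (auto simp: incseq_def range_subsetD intro: less_le_trans)
    also have "(\<Union>n. \<Union>i<n. A i) = (\<Union>i. A i)" by auto
    also have "(\<lambda>n. LINT x:(\<Union>i<n. A i)|P. f x) = (\<lambda>n. \<Sum>i<n. LINT x:A i|P. f x)"
      using A by (intro ext set_integral_finite_Union int) (auto simp: disjoint_family_on_def)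
    finally have "(\<lambda>i. LINT x:A i|P. f x) sums (LINT x:(\<Union>i. A i)|P. f x)"
      by (simp add: sums_def)
    with A show ?thesis by (simp add: signed_density_def range_subsetD)
  qed
  moreover have "signed_density P f A = 0" if "A \<in> null_sets P" for A
    using that AE_not_in[OF that] unfolding signed_density_def set_lebesgue_integral_def
    by (auto intro!: integral_eq_zero_AE)
  ultimately show ?thesis
    by (auto simp: ac_signed_measures_def signed_measures_def signed_density_def
       set_lebesgue_integral_def)
qed

section \<open>Variations, integrals and divergence in terms of densities\<close>

text \<open>The supremum over subsets of \<open>A\<close> is attained at \<open>A \<inter> {f \<ge> 0}\<close>.\<close>
lemma sup_charge_signed_density:
  assumes f: "integrable P f" and A: "A \<in> sets P"
  shows "sup_charge P (signed_density P f) A = emeasure (density P (\<lambda>x. ennreal (f x))) A"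
proof -
  have [measurable]: "f \<in> borel_measurable P" using f by auto
  have [measurable]: "A \<in> sets P" by (rule A)
  let ?p = "\<lambda>x. indicator A x * max 0 (f x)"
  have p: "integrable P ?p"
    using integrable_mult_indicator[OF A, of "\<lambda>x. max 0 (f x)"] f by simp
  have eq: "emeasure (density P (\<lambda>x. ennreal (f x))) A = ennreal (LINT x|P. ?p x)"
  proof -
    have "emeasure (density P (\<lambda>x. ennreal (f x))) A = (\<integral>\<^sup>+x. ennreal (?p x) \<partial>P)"
      using A by (subst emeasure_density)
        (auto intro!: nn_integral_cong simp: indicator_def max_def ennreal_neg)
    also have "\<dots> = ennreal (LINT x|P. ?p x)"
      using p by (intro nn_integral_eq_integral) auto
    finally show ?thesis .
  qed
  show ?thesis
  proof (rule antisym)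
    show "sup_charge P (signed_density P f) A \<le> emeasure (density P (\<lambda>x. ennreal (f x))) A"
      unfolding eq
    proof (rule sup_charge_least)
      fix B assume B: "B \<in> sets P" "B \<subseteq> A"
      have "(LINT x|P. indicator B x *\<^sub>R f x) \<le> (LINT x|P. ?p x)"
        using integrable_mult_indicator[OF B(1) f] p B(2)
        by (intro integral_mono) (auto simp: indicator_def)
      then show "ennreal (signed_density P f B) \<le> ennreal (LINT x|P. ?p x)"
        using B by (intro ennreal_leI) (simp add: signed_density_def set_lebesgue_integral_def)
    qed
  next
    define B where "B = {x \<in> space P. 0 \<le> f x} \<inter> A"
    have B: "B \<in> sets P" "B \<subseteq> A" unfolding B_def by auto
    have "(LINT x|P. ?p x) = (LINT x|P. indicator B x *\<^sub>R f x)"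
      by (intro Bochner_Integration.integral_cong) (auto simp: indicator_def B_def)
    then have "(LINT x|P. ?p x) = signed_density P f B"
      using B by (simp add: signed_density_def set_lebesgue_integral_def)
    then show "emeasure (density P (\<lambda>x. ennreal (f x))) A \<le> sup_charge P (signed_density P f) A"
      unfolding eq using B sup_charge_upper by metis
  qed
qed

lemma pos_variation_signed_density:
  assumes f: "integrable P f"
  shows "pos_variation P (signed_density P f) = density P (\<lambda>x. ennreal (f x))"
proof (rule measure_eqI)
  fix A assume "A \<in> sets (pos_variation P (signed_density P f))"
  then have "A \<in> sets P" by simp
  moreover have "signed_density P f \<in> signed_measures P"
    using signed_density_ac[OF f] by (simp add: ac_signed_measures_def)
  ultimately show "emeasure (pos_variation P (signed_density P f)) A = emeasure (density P (\<lambda>x. ennreal (f x))) A"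
    by (simp add: emeasure_pos_variation sup_charge_signed_density[OF f])
qed simp

lemma neg_variation_signed_density:
  assumes f: "integrable P f"
  shows "neg_variation P (signed_density P f) = density P (\<lambda>x. ennreal (- f x))"
proof -
  have "(\<lambda>A. - signed_density P f A) = signed_density P (\<lambda>x. - f x)"
    by (auto simp: signed_density_def set_lebesgue_integral_def fun_eq_iff)
  then show ?thesis
    unfolding neg_variation_def using f by (simp add: pos_variation_signed_density)
qed

lemma total_variation_signed_density:
  assumes f: "integrable P f"
  shows "total_variation P (signed_density P f) = density P (\<lambda>x. ennreal \<bar>f x\<bar>)"
proof -
  have [measurable]: "f \<in> borel_measurable P" using f by auto
  have "emeasure (density P (\<lambda>x. ennreal (f x))) A + emeasure (density P (\<lambda>x. ennreal (- f x))) A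
      = emeasure (density P (\<lambda>x. ennreal \<bar>f x\<bar>)) A" if [measurable]: "A \<in> sets P" for A
  proof -
    have "emeasure (density P (\<lambda>x. ennreal (f x))) A + emeasure (density P (\<lambda>x. ennreal (- f x))) A
       = (\<integral>\<^sup>+x. ennreal (f x) * indicator A x + ennreal (- f x) * indicator A x \<partial>P)"
      by (simp add: emeasure_density nn_integral_add)
    also have "\<dots> = (\<integral>\<^sup>+x. ennreal \<bar>f x\<bar> * indicator A x \<partial>P)"
      by (intro nn_integral_cong) (auto simp: indicator_def abs_if ennreal_neg)
    finally show ?thesis by (simp add: emeasure_density)
  qed
  then have "total_variation P (signed_density P f)
      = measure_of (space P) (sets P) (emeasure (density P (\<lambda>x. ennreal \<bar>f x\<bar>)))"
    unfolding total_variation_def pos_variation_signed_density[OF f] neg_variation_signed_density[OF f]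
    by (intro measure_of_eq) (auto simp: sets.space_closed sets.sigma_sets_eq)
  also have "\<dots> = density P (\<lambda>x. ennreal \<bar>f x\<bar>)"
    using measure_of_of_measure[of "density P (\<lambda>x. ennreal \<bar>f x\<bar>)"] by simp
  finally show ?thesis .
qed

lemma integrable_total_variation_signed_density:
  fixes h :: "'a \<Rightarrow> real"
  assumes f: "integrable P f" and [measurable]: "h \<in> borel_measurable P"
  shows "integrable (total_variation P (signed_density P f)) h \<longleftrightarrow> integrable P (\<lambda>x. f x * h x)"
proof -
  have [measurable]: "f \<in> borel_measurable P" using f by auto
  have "integrable (total_variation P (signed_density P f)) h \<longleftrightarrow> integrable P (\<lambda>x. \<bar>f x\<bar> * h x)"
    unfolding total_variation_signed_density[OF f] by (subst integrable_density) auto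
  also have "\<dots> \<longleftrightarrow> integrable P (\<lambda>x. norm (\<bar>f x\<bar> * h x))"
    by (rule integrable_norm_iff[symmetric]) simp
  also have "\<dots> \<longleftrightarrow> integrable P (\<lambda>x. norm (f x * h x))"
    by (simp add: abs_mult)
  also have "\<dots> \<longleftrightarrow> integrable P (\<lambda>x. f x * h x)"
    by (rule integrable_norm_iff) simp
  finally show ?thesis .
qed

text \<open>The two variations have densities \<open>max 0 f\<close> and \<open>max 0 (- f)\<close>, whose difference is \<open>f\<close>.\<close>
lemma signed_integral_signed_density:
  assumes f: "integrable P f" and [measurable]: "h \<in> borel_measurable P"
    and fh: "integrable P (\<lambda>x. f x * h x)"
  shows "signed_integral P (signed_density P f) h = (LINT x|P. f x * h x)"
proof -
  have [measurable]: "f \<in> borel_measurable P" using f by auto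
  have d: "density P (\<lambda>x. ennreal (u x)) = density P (\<lambda>x. ennreal (max 0 (u x)))" for u :: "'a \<Rightarrow> real"
    by (rule arg_cong[where f = "density P"]) (auto simp: fun_eq_iff max_def ennreal_neg)
  have int: "integrable P (\<lambda>x. max 0 (f x) * h x)" "integrable P (\<lambda>x. max 0 (- f x) * h x)"
    by (rule Bochner_Integration.integrable_bound[OF fh], simp,
        rule AE_I2, simp add: abs_mult max_def mult_nonneg_nonneg mult_nonpos_nonneg)+
  have "signed_integral P (signed_density P f) h
      = (LINT x|P. max 0 (f x) * h x) - (LINT x|P. max 0 (- f x) * h x)"
    unfolding signed_integral_def pos_variation_signed_density[OF f]
      neg_variation_signed_density[OF f] d[of f] d[of "\<lambda>x. - f x"]
    by (simp add: integral_density)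
  also have "\<dots> = (LINT x|P. max 0 (f x) * h x - max 0 (- f x) * h x)"
    using int by simp
  also have "\<dots> = (LINT x|P. f x * h x)"
    by (intro Bochner_Integration.integral_cong) (auto simp: max_def)
  finally show ?thesis .
qed

lemma signed_density_in_constraint_set_iff:
  fixes g :: "'l::finite \<Rightarrow> 'a \<Rightarrow> real"
  assumes g: "\<And>i. g i \<in> borel_measurable P" and f: "integrable P f"
  shows "signed_density P f \<in> constraint_set P g \<longleftrightarrow>
    (\<forall>i. integrable P (\<lambda>x. f x * g i x)) \<and> (LINT x|P. f x) = 1 \<and> (\<forall>i. (LINT x|P. f x * g i x) = 0)"
proof -
  have "signed_density P f (space P) = (LINT x|P. f x)"
    by (auto simp: signed_density_def set_lebesgue_integral_def intro!: Bochner_Integration.integral_cong)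
  then show ?thesis
    unfolding constraint_set_def
    using signed_density_ac[OF f] integrable_total_variation_signed_density[OF f g]
      signed_integral_signed_density[OF f g] by auto
qed

text \<open>The chosen derivative \<^const>\<open>signed_RN_deriv\<close> agrees with any given density up to a null set.\<close>
lemma divergence_signed_density:
  assumes f: "integrable P f"
  shows "divergence \<phi> P (signed_density P f) = (\<integral>\<^sup>+ x. \<phi> (f x) \<partial>P)"
proof -
  let ?r = "signed_RN_deriv P (signed_density P f)"
  have r: "integrable P ?r \<and> signed_density P f = signed_density P ?r"
    unfolding signed_RN_deriv_def by (rule someI[of _ f]) (use f in simp)
  then have "AE x in P. f x = ?r x"
    using signed_density_AE_unique[OF f] by blast
  then have "(\<integral>\<^sup>+ x. \<phi> (?r x) \<partial>P) = (\<integral>\<^sup>+ x. \<phi> (f x) \<partial>P)"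
    by (intro nn_integral_cong_AE) auto
  then show ?thesis using signed_density_ac[OF f] by (simp add: divergence_def)
qed

section \<open>The derivative of a convex function and its inverse\<close>

lemma between_eq:
  assumes "u < x" "x < (w::real)"
  obtains t where "t \<in> {0<..<1}" "x = (1 - t) * u + t * w"
proof -
  define t where "t = (x - u) / (w - u)"
  have "t * (w - u) = x - u" using assms by (simp add: t_def)
  then have "x = (1 - t) * u + t * w" by (simp add: algebra_simps)
  moreover have "t \<in> {0<..<1}" using assms by (auto simp: t_def field_simps)
  ultimately show thesis using that by blast
qed

lemma ereal_dense_real:
  assumes "x < (y::ereal)"
  obtains r where "x < ereal r" "ereal r < y"
  using ereal_dense2[OF assms] that by auto

lemma not_bounded_linear:
  fixes c d e :: real
  assumes "e > 0" "\<And>y. y \<ge> 1 \<Longrightarrow> e * y + c \<le> d"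
  shows False
proof -
  have "e * (max 1 ((d - c) / e + 1)) \<ge> e * ((d - c) / e + 1)" using assms(1) by (intro mult_left_mono) auto
  also have "e * ((d - c) / e + 1) = d - c + e" using assms(1) by (simp add: field_simps)
  finally show False using assms(2)[of "max 1 ((d - c) / e + 1)"] assms(1) by linarith
qed

locale smooth_divergence =
  fixes \<phi> :: "real \<Rightarrow> ennreal"
  assumes divergence_function: "divergence_function \<phi>"
    and differentiable: "differentiable_fun \<phi>"
    and strictly_convex: "strictly_convex_fun \<phi>"
begin

text \<open>\<open>F\<close> has the value 0 where \<open>\<phi>\<close> is infinite, so statements about \<open>F x\<close> carry the hypothesis
  \<open>\<phi> x < \<infinity>\<close>.\<close>
abbreviation "F x \<equiv> enn2real (\<phi> x)"

abbreviation "D \<equiv> deriv (\<lambda>x. enn2real (\<phi> x))"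

abbreviation "interior_dom \<equiv> {x. dom_lower \<phi> < ereal x \<and> ereal x < dom_upper \<phi>}"

abbreviation "\<psi> t \<equiv> phi_deriv_inv \<phi> (ereal t)"

lemma phi_1 [simp]: "\<phi> 1 = 0" and dom_bounds: "dom_lower \<phi> < 1" "1 < dom_upper \<phi>"
  using divergence_function by (auto simp: divergence_function_def)

lemma dom_bounds_real: "\<phi> x < \<infinity> \<Longrightarrow> dom_lower \<phi> \<le> ereal x \<and> ereal x \<le> dom_upper \<phi>"
  by (auto simp: dom_lower_def dom_upper_def intro: INF_lower SUP_upper)

lemma interior_between:
  "u \<in> interior_dom \<Longrightarrow> w \<in> interior_dom \<Longrightarrow> u \<le> x \<Longrightarrow> x \<le> w \<Longrightarrow> x \<in> interior_dom"
  using less_le_trans[of "dom_lower \<phi>" "ereal u" "ereal x"] le_less_trans[of "ereal x" "ereal w" "dom_upper \<phi>"]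
  by simp

lemma interiorI:
  assumes "dom_lower \<phi> \<le> x" "x < ereal r" "ereal r < y" "y \<le> dom_upper \<phi>"
  shows "r \<in> interior_dom"
  using le_less_trans[OF assms(1,2)] less_le_trans[OF assms(3,4)] by simp

lemma phi_eq: "\<phi> x < \<infinity> \<Longrightarrow> \<phi> x = ennreal (F x)"
  by (simp add: less_top)

lemma phi_convex:
  "t \<in> {0..1} \<Longrightarrow> \<phi> ((1 - t) * x + t * y) \<le> ennreal (1 - t) * \<phi> x + ennreal t * \<phi> y"
  using divergence_function by (auto simp: divergence_function_def convex_fun_def)

lemma F_convex:
  assumes t: "t \<in> {0..1}" and x: "\<phi> x < \<infinity>" and y: "\<phi> y < \<infinity>"
  shows "\<phi> ((1 - t) * x + t * y) < \<infinity>" "F ((1 - t) * x + t * y) \<le> (1 - t) * F x + t * F y"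
proof -
  have "\<phi> ((1 - t) * x + t * y) \<le> ennreal (1 - t) * ennreal (F x) + ennreal t * ennreal (F y)"
    using phi_convex[OF t, of x y] phi_eq[OF x] phi_eq[OF y] by simp
  also have "\<dots> = ennreal ((1 - t) * F x + t * F y)"
    using t by (simp add: ennreal_mult ennreal_plus)
  finally have le: "\<phi> ((1 - t) * x + t * y) \<le> ennreal ((1 - t) * F x + t * F y)" .
  then show "\<phi> ((1 - t) * x + t * y) < \<infinity>"
    by (simp add: le_less_trans)
  show "F ((1 - t) * x + t * y) \<le> (1 - t) * F x + t * F y"
    using t by (intro enn2real_leI[OF _ le]) auto
qed

lemma phi_interior_finite:
  assumes "x \<in> interior_dom"
  shows "\<phi> x < \<infinity>"
proof -
  obtain u where u: "\<phi> u < \<infinity>" "u < x" using assms by (auto simp: dom_lower_def INF_less_iff)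
  obtain w where w: "\<phi> w < \<infinity>" "x < w" using assms by (auto simp: dom_upper_def less_SUP_iff)
  obtain t where "t \<in> {0<..<1}" "x = (1 - t) * u + t * w" using between_eq[OF u(2) w(2)] by blast
  then show ?thesis using F_convex(1)[of t u w] u w by auto
qed

lemma F_strictly_convex:
  assumes x: "x \<in> interior_dom" and y: "y \<in> interior_dom" and xy: "x \<noteq> y"
  shows "F ((x + y) / 2) < (F x + F y) / 2"
proof -
  have half: "(1 - 1/2) * x + 1/2 * y = (x + y) / 2" by (simp add: field_simps)
  have "\<phi> ((1 - 1/2) * x + 1/2 * y) < ennreal (1 - 1/2) * \<phi> x + ennreal (1/2) * \<phi> y"
    using strictly_convex[unfolded strictly_convex_fun_def, rule_format, of "1/2" x y] x y xy by auto
  then have "\<phi> ((x + y) / 2) < ennreal (1/2) * \<phi> x + ennreal (1/2) * \<phi> y"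
    unfolding half by simp
  also have "\<dots> = ennreal (1/2) * ennreal (F x) + ennreal (1/2) * ennreal (F y)"
    using phi_eq phi_interior_finite x y by simp
  also have "\<dots> = ennreal ((F x + F y) / 2)"
  proof -
    have m: "ennreal (1/2 * c) = ennreal (1/2) * ennreal c" if "c \<ge> 0" for c
      by (rule ennreal_mult) (use that in auto)
    have "ennreal (1/2 * F x + 1/2 * F y) = ennreal (1/2 * F x) + ennreal (1/2 * F y)"
      by (rule ennreal_plus) auto
    then show ?thesis unfolding m[OF enn2real_nonneg] by (simp add: add_divide_distrib)
  qed
  finally have lt: "\<phi> ((x + y) / 2) < ennreal ((F x + F y) / 2)" .
  then have "ennreal (F ((x + y) / 2)) < ennreal ((F x + F y) / 2)"
    using phi_eq[of "(x + y) / 2"] by (metis ennreal_less_top infinity_ennreal_def order_less_trans)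
  then show ?thesis by (simp add: ennreal_less_iff)
qed

lemma F_deriv: "x \<in> interior_dom \<Longrightarrow> ((\<lambda>x. F x) has_real_derivative D x) (at x)"
  using differentiable by (auto simp: differentiable_fun_def DERIV_deriv_iff_real_differentiable)

text \<open>By convexity the difference quotients of \<open>F\<close> at \<open>y\<close> in the direction \<open>x - y\<close> are bounded by the
  one of step width 1. The point \<open>x\<close> may be an endpoint of the domain.\<close>
lemma tangent_le:
  assumes y: "y \<in> interior_dom" and x: "\<phi> x < \<infinity>"
  shows "F y + D y * (x - y) \<le> F x"
proof -
  have "((\<lambda>t. F (y + t * (x - y))) has_real_derivative D y * (x - y)) (at 0)"
  proof -
    have "((\<lambda>t. y + t * (x - y)) has_real_derivative x - y) (at 0)"
      by (auto intro!: derivative_eq_intros)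
    from DERIV_chain'[OF this, of F "D y"] F_deriv[OF y] show ?thesis by simp
  qed
  then have "((\<lambda>t. (F (y + t * (x - y)) - F y) / t) \<longlongrightarrow> D y * (x - y)) (at 0)"
    unfolding DERIV_def by simp
  then have "((\<lambda>t. (F (y + t * (x - y)) - F y) / t) \<longlongrightarrow> D y * (x - y)) (at_right 0)"
    by (rule tendsto_within_subset) simp
  moreover have "\<forall>\<^sub>F t in at_right 0. (F (y + t * (x - y)) - F y) / t \<le> F x - F y"
    unfolding eventually_at_right_field
  proof (intro exI[of _ 1] conjI allI impI)
    fix t :: real assume t: "0 < t" "t < 1"
    have "y + t * (x - y) = (1 - t) * y + t * x" by (simp add: algebra_simps)
    then have "F (y + t * (x - y)) - F y \<le> t * (F x - F y)"
      using F_convex(2)[of t y x] t x phi_interior_finite[OF y] by (simp add: algebra_simps)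
    then show "(F (y + t * (x - y)) - F y) / t \<le> F x - F y"
      using t by (simp add: divide_le_eq mult.commute)
  qed simp
  ultimately have "D y * (x - y) \<le> F x - F y"
    by (rule tendsto_upperbound) simp
  then show ?thesis by simp
qed

text \<open>At the midpoint of \<open>x\<close> and \<open>y\<close> the tangent lies below \<open>F\<close>, and \<open>F\<close> lies strictly below the chord.\<close>
lemma tangent_less_interior:
  assumes y: "y \<in> interior_dom" and x: "x \<in> interior_dom" "x \<noteq> y"
  shows "F y + D y * (x - y) < F x"
proof -
  have "(x + y) / 2 \<in> interior_dom"
    using interior_between[of x y "(x + y) / 2"] interior_between[of y x "(x + y) / 2"] x y
    by (cases "x \<le> y") auto
  then have "F y + D y * ((x + y) / 2 - y) \<le> F ((x + y) / 2)"
    by (intro tangent_le y phi_interior_finite)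
  also have "\<dots> < (F x + F y) / 2" by (rule F_strictly_convex) fact+
  finally show ?thesis by (simp add: field_simps)
qed

lemma D_strict_mono:
  assumes "x \<in> interior_dom" "y \<in> interior_dom" "x < y"
  shows "D x < D y"
proof -
  have "F x + D x * (y - x) < F y" "F y + D y * (x - y) < F x"
    using assms by (auto intro!: tangent_less_interior)
  then have "D x * (y - x) < D y * (y - x)" by (simp add: algebra_simps)
  then show ?thesis using assms(3) by simp
qed

text \<open>The Darboux property: a minimizer of \<open>F x - t x\<close> on the segment is not an endpoint, since this
  function decreases at \<open>u\<close> and increases towards \<open>w\<close>.\<close>
lemma D_intermediate:
  assumes u: "u \<in> interior_dom" and w: "w \<in> interior_dom" and uw: "u < w"
    and t: "D u < t" "t < D w"
  obtains x where "u < x" "x < w" "D x = t"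
proof -
  define k where "k x = F x - t * x" for x
  have der: "(k has_real_derivative D x - t) (at x)" if "u \<le> x" "x \<le> w" for x
    unfolding k_def using interior_between[OF u w that]
    by (auto intro!: derivative_eq_intros F_deriv)
  have "continuous_on {u..w} k"
    by (intro continuous_at_imp_continuous_on ballI DERIV_isCont[OF der]) auto
  then obtain x where x: "x \<in> {u..w}" "\<And>y. y \<in> {u..w} \<Longrightarrow> k x \<le> k y"
    using continuous_attains_inf[of "{u..w}" k] uw by auto
  have "x \<noteq> u"
  proof
    assume "x = u"
    obtain d where d: "d > 0" "\<And>h. 0 < h \<Longrightarrow> h < d \<Longrightarrow> k (u + h) < k u"
      using DERIV_neg_dec_right[OF der[of u]] t uw by auto
    then have "k (u + min (d/2) (w - u)) < k u" using uw by (intro d) auto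
    moreover have "k u \<le> k (u + min (d/2) (w - u))" using x(2) uw d(1) \<open>x = u\<close> by auto
    ultimately show False by simp
  qed
  moreover have "x \<noteq> w"
  proof
    assume "x = w"
    obtain d where d: "d > 0" "\<And>h. 0 < h \<Longrightarrow> h < d \<Longrightarrow> k (w - h) < k w"
      using DERIV_pos_inc_left[OF der[of w]] t uw by auto
    then have "k (w - min (d/2) (w - u)) < k w" using uw by (intro d) auto
    moreover have "k w \<le> k (w - min (d/2) (w - u))" using x(2) uw d(1) \<open>x = w\<close> by auto
    ultimately show False by simp
  qed
  ultimately have ux: "u < x" "x < w" using x(1) by auto
  have "D x - t = 0"
  proof (rule DERIV_local_min[OF der])
    show "0 < min (x - u) (w - x)" using ux by simp
    show "\<forall>y. \<bar>x - y\<bar> < min (x - u) (w - x) \<longrightarrow> k x \<le> k y"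
    proof (intro allI impI)
      fix y assume "\<bar>x - y\<bar> < min (x - u) (w - x)"
      then have "y \<in> {u..w}" by (auto simp: abs_less_iff)
      then show "k x \<le> k y" by (rule x(2))
    qed
  qed (use ux in auto)
  with that ux show ?thesis by simp
qed

lemma phi_deriv_interior: "x \<in> interior_dom \<Longrightarrow> phi_deriv \<phi> (ereal x) = ereal (D x)"
  by (auto simp: phi_deriv_def Let_def)

text \<open>The one-sided limits that define \<^const>\<open>phi_deriv\<close> at the endpoints exist because the derivative
  is monotone; they are its infimum and supremum.\<close>
lemma phi_deriv_lower: "phi_deriv \<phi> (dom_lower \<phi>) = (INF x \<in> interior_dom. ereal (D x))"
proof -
  define d where "d y = ereal (D (real_of_ereal y))" for y
  have "(d \<longlongrightarrow> (INF x \<in> interior_dom. ereal (D x))) (at_right (dom_lower \<phi>))"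
  proof (rule order_tendstoI)
    fix c assume c: "c < (INF x \<in> interior_dom. ereal (D x))"
    have "c < d y" if y: "dom_lower \<phi> < y" "y < 1" for y
    proof -
      obtain r where r: "y = ereal r" using y by (cases y) auto
      have "r \<in> interior_dom"
        using y dom_bounds unfolding r by (intro interiorI[of "dom_lower \<phi>" r 1]) auto
      then show ?thesis
        using less_le_trans[OF c INF_lower[of r interior_dom "\<lambda>x. ereal (D x)"]] by (simp add: d_def r)
    qed
    then show "\<forall>\<^sub>F y in at_right (dom_lower \<phi>). c < d y"
      unfolding eventually_at_right[OF dom_bounds(1)] using dom_bounds by auto
  next
    fix c assume "(INF x \<in> interior_dom. ereal (D x)) < c"
    then obtain x where x: "x \<in> interior_dom" "ereal (D x) < c" unfolding INF_less_iff by auto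
    have "d y < c" if y: "dom_lower \<phi> < y" "y < ereal x" for y
    proof -
      obtain r where r: "y = ereal r" using y by (cases y) auto
      have "r \<in> interior_dom"
        using y x unfolding r by (intro interiorI[of "dom_lower \<phi>" r "ereal x"]) auto
      then have "D r < D x"
        using y x r by (intro D_strict_mono) auto
      then show ?thesis using less_trans[of "ereal (D r)" "ereal (D x)" c] x by (simp add: d_def r)
    qed
    then show "\<forall>\<^sub>F y in at_right (dom_lower \<phi>). d y < c"
      using x(1) unfolding eventually_at_right[OF dom_bounds(1)] by blast
  qed
  moreover have "at_right (dom_lower \<phi>) \<noteq> bot"
    using dom_bounds dense unfolding trivial_limit_def eventually_at_right[OF dom_bounds(1)] by blast
  ultimately show ?thesis
    unfolding phi_deriv_def Let_def d_def by (simp add: tendsto_Lim)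
qed

lemma phi_deriv_upper: "phi_deriv \<phi> (dom_upper \<phi>) = (SUP x \<in> interior_dom. ereal (D x))"
proof -
  define d where "d y = ereal (D (real_of_ereal y))" for y
  have "(d \<longlongrightarrow> (SUP x \<in> interior_dom. ereal (D x))) (at_left (dom_upper \<phi>))"
  proof (rule order_tendstoI)
    fix c assume c: "(SUP x \<in> interior_dom. ereal (D x)) < c"
    have "d y < c" if y: "1 < y" "y < dom_upper \<phi>" for y
    proof -
      obtain r where r: "y = ereal r" using y by (cases y) auto
      have "r \<in> interior_dom"
        using y dom_bounds unfolding r by (intro interiorI[of 1 r "dom_upper \<phi>"]) auto
      then show ?thesis
        using le_less_trans[OF SUP_upper[of r interior_dom "\<lambda>x. ereal (D x)"] c] by (simp add: d_def r)
    qed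
    then show "\<forall>\<^sub>F y in at_left (dom_upper \<phi>). d y < c"
      unfolding eventually_at_left[OF dom_bounds(2)] using dom_bounds by auto
  next
    fix c assume "c < (SUP x \<in> interior_dom. ereal (D x))"
    then obtain x where x: "x \<in> interior_dom" "c < ereal (D x)" unfolding less_SUP_iff by auto
    have "c < d y" if y: "ereal x < y" "y < dom_upper \<phi>" for y
    proof -
      obtain r where r: "y = ereal r" using y by (cases y) auto
      have "r \<in> interior_dom"
        using y x unfolding r by (intro interiorI[of "ereal x" r "dom_upper \<phi>"]) auto
      then have "D x < D r"
        using y x r by (intro D_strict_mono) auto
      then show ?thesis using less_trans[of c "ereal (D x)" "ereal (D r)"] x by (simp add: d_def r)
    qed
    then show "\<forall>\<^sub>F y in at_left (dom_upper \<phi>). c < d y"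
      using x(1) unfolding eventually_at_left[OF dom_bounds(2)] by blast
  qed
  moreover have "at_left (dom_upper \<phi>) \<noteq> bot"
    using dom_bounds dense unfolding trivial_limit_def eventually_at_left[OF dom_bounds(2)] by blast
  ultimately show ?thesis
    using dom_bounds unfolding phi_deriv_def Let_def d_def by (auto simp: tendsto_Lim)
qed

lemma phi_deriv_less:
  assumes "dom_lower \<phi> \<le> x" "x < ereal z" "z \<in> interior_dom"
  shows "phi_deriv \<phi> x < ereal (D z)"
proof (cases "x = dom_lower \<phi>")
  case True
  obtain r where r: "dom_lower \<phi> < ereal r" "ereal r < ereal z"
    using ereal_dense_real assms(3) by blast
  have "r \<in> interior_dom"
    using r assms(3) by (intro interiorI[of "dom_lower \<phi>" r "ereal z"]) auto
  then have "phi_deriv \<phi> x \<le> ereal (D r)" "D r < D z"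
    using r assms(3) D_strict_mono[of r z] by (auto simp: True phi_deriv_lower intro: INF_lower)
  then show ?thesis using le_less_trans[of _ "ereal (D r)" "ereal (D z)"] by simp
next
  case False
  then obtain r where r: "x = ereal r" using assms by (cases x) auto
  have "r \<in> interior_dom"
    using assms False less_trans[of "ereal r" "ereal z" "dom_upper \<phi>"] unfolding r by auto
  then show ?thesis using D_strict_mono[of r z] assms by (simp only: r phi_deriv_interior) auto
qed

lemma phi_deriv_greater:
  assumes "x \<le> dom_upper \<phi>" "ereal z < x" "z \<in> interior_dom"
  shows "ereal (D z) < phi_deriv \<phi> x"
proof (cases "x = dom_upper \<phi>")
  case True
  obtain r where r: "ereal z < ereal r" "ereal r < dom_upper \<phi>"
    using ereal_dense_real assms(3) by blast
  have "r \<in> interior_dom"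
    using r assms(3) by (intro interiorI[of "ereal z" r "dom_upper \<phi>"]) auto
  then have "ereal (D r) \<le> phi_deriv \<phi> x" "D z < D r"
    using r assms(3) D_strict_mono[of z r] by (auto simp: True phi_deriv_upper intro: SUP_upper)
  then show ?thesis using less_le_trans[of "ereal (D z)" "ereal (D r)"] by simp
next
  case False
  then obtain r where r: "x = ereal r" using assms by (cases x) auto
  have "r \<in> interior_dom"
    using assms False less_trans[of "dom_lower \<phi>" "ereal z" "ereal r"] unfolding r by auto
  then show ?thesis using D_strict_mono[of z r] assms by (simp only: r phi_deriv_interior) auto
qed

lemma phi_deriv_strict_mono:
  assumes "dom_lower \<phi> \<le> x" "x < y" "y \<le> dom_upper \<phi>"
  shows "phi_deriv \<phi> x < phi_deriv \<phi> y"
proof -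
  obtain z where z: "x < ereal z" "ereal z < y" using ereal_dense_real[OF assms(2)] by blast
  then have "z \<in> interior_dom" using assms by (intro interiorI)
  with z assms have "phi_deriv \<phi> x < ereal (D z)" "ereal (D z) < phi_deriv \<phi> y"
    by (auto intro: phi_deriv_less phi_deriv_greater)
  then show ?thesis by (rule less_trans)
qed

lemma phi_deriv_surj:
  assumes "phi_deriv \<phi> (dom_lower \<phi>) \<le> ereal t" "ereal t \<le> phi_deriv \<phi> (dom_upper \<phi>)"
  obtains x where "x \<in> {dom_lower \<phi>..dom_upper \<phi>}" "phi_deriv \<phi> x = ereal t"
proof -
  have ab: "dom_lower \<phi> \<le> dom_upper \<phi>" using dom_bounds by (auto intro: less_imp_le less_trans)
  show ?thesis
  proof (cases "phi_deriv \<phi> (dom_lower \<phi>) = ereal t \<or> phi_deriv \<phi> (dom_upper \<phi>) = ereal t")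
    case True then show ?thesis using that ab by auto
  next
    case False
    then have "phi_deriv \<phi> (dom_lower \<phi>) < ereal t" "ereal t < phi_deriv \<phi> (dom_upper \<phi>)"
      using assms by (auto simp: less_le)
    then obtain u w where u: "u \<in> interior_dom" "D u < t" and w: "w \<in> interior_dom" "t < D w"
      unfolding phi_deriv_lower phi_deriv_upper INF_less_iff less_SUP_iff by auto
    have "u < w"
      using D_strict_mono[OF w(1) u(1)] u w by (cases u w rule: linorder_cases) auto
    from D_intermediate[OF u(1) w(1) this u(2) w(2)]
    obtain x where x: "u < x" "x < w" "D x = t" by blast
    then have "x \<in> interior_dom" using interior_between[OF u(1) w(1)] by auto
    then show ?thesis using that[of "ereal x"] x phi_deriv_interior[of x] by (simp add: less_imp_le)
  qed
qed

text \<open>\<open>\<psi> t\<close> is the place where the derivative crosses the level \<open>t\<close>. As the derivative is strictly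
  increasing, this determines \<open>\<psi> t\<close>, also when \<open>t\<close> is outside the image of the derivative or when
  \<open>\<psi> t\<close> is infinite. All further properties of \<open>\<psi>\<close> are derived from it.\<close>
lemma psi_crossing:
  shows psi_bounds: "dom_lower \<phi> \<le> \<psi> t" "\<psi> t \<le> dom_upper \<phi>"
    and D_less: "y \<in> interior_dom \<Longrightarrow> ereal y < \<psi> t \<Longrightarrow> D y < t"
    and D_greater: "y \<in> interior_dom \<Longrightarrow> \<psi> t < ereal y \<Longrightarrow> t < D y"
proof -
  have ab: "dom_lower \<phi> \<le> dom_upper \<phi>" using dom_bounds by (auto intro: less_imp_le less_trans)
  have "dom_lower \<phi> \<le> \<psi> t \<and> \<psi> t \<le> dom_upper \<phi> \<and>
    (\<forall>y \<in> interior_dom. (ereal y < \<psi> t \<longrightarrow> D y < t) \<and> (\<psi> t < ereal y \<longrightarrow> t < D y))"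
  proof -
    consider (lo) "ereal t < phi_deriv \<phi> (dom_lower \<phi>)"
      | (hi) "phi_deriv \<phi> (dom_lower \<phi>) \<le> ereal t" "phi_deriv \<phi> (dom_upper \<phi>) < ereal t"
      | (mid) "phi_deriv \<phi> (dom_lower \<phi>) \<le> ereal t" "ereal t \<le> phi_deriv \<phi> (dom_upper \<phi>)"
      by fastforce
    then show ?thesis
    proof cases
      case lo
      then have "\<psi> t = dom_lower \<phi>" by (simp add: phi_deriv_inv_def)
      moreover have "t < D y" if "y \<in> interior_dom" for y
        using lo INF_lower[OF that, of "\<lambda>x. ereal (D x)"] unfolding phi_deriv_lower
        by (metis less_le_trans less_ereal.simps(1))
      ultimately show ?thesis using ab by auto
    next
      case hi
      then have "\<psi> t = dom_upper \<phi>" by (simp add: phi_deriv_inv_def leD)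
      moreover have "D y < t" if "y \<in> interior_dom" for y
        using hi SUP_upper[OF that, of "\<lambda>x. ereal (D x)"] unfolding phi_deriv_upper
        by (metis le_less_trans less_ereal.simps(1))
      ultimately show ?thesis using ab by auto
    next
      case mid
      then obtain x where x: "x \<in> {dom_lower \<phi>..dom_upper \<phi>}" "phi_deriv \<phi> x = ereal t"
        using phi_deriv_surj by blast
      have inj: "inj_on (phi_deriv \<phi>) {dom_lower \<phi>..dom_upper \<phi>}"
      proof (rule inj_onI)
        fix x y assume "x \<in> {dom_lower \<phi>..dom_upper \<phi>}" "y \<in> {dom_lower \<phi>..dom_upper \<phi>}"
          "phi_deriv \<phi> x = phi_deriv \<phi> y"
        then show "x = y"
          using phi_deriv_strict_mono[of x y] phi_deriv_strict_mono[of y x]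
          by (cases x y rule: linorder_cases) auto
      qed
      have "\<psi> t = x"
        using mid the_inv_into_f_f[OF inj x(1)] x(2) by (simp add: phi_deriv_inv_def leD)
      then show ?thesis
        using x phi_deriv_less[of x] phi_deriv_greater[of x] by auto
    qed
  qed
  then show "dom_lower \<phi> \<le> \<psi> t" "\<psi> t \<le> dom_upper \<phi>"
    "y \<in> interior_dom \<Longrightarrow> ereal y < \<psi> t \<Longrightarrow> D y < t"
    "y \<in> interior_dom \<Longrightarrow> \<psi> t < ereal y \<Longrightarrow> t < D y" by auto
qed

section \<open>Equality in the Young inequality\<close>

lemma enn2ereal_phi: "\<phi> x < \<infinity> \<Longrightarrow> enn2ereal (\<phi> x) = ereal (F x)"
  using enn2ereal_ennreal[of "F x"] phi_eq[of x] by simp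

lemma conjugate_ge:
  assumes "\<phi> x < \<infinity>"
  shows "ereal (t * x - F x) \<le> conjugate \<phi> t"
proof -
  have "ereal (t * x) - enn2ereal (\<phi> x) = ereal (t * x - F x)"
    using enn2ereal_phi[OF assms] by simp
  then show ?thesis
    unfolding conjugate_def using SUP_upper[of x UNIV "\<lambda>x. ereal (t * x) - enn2ereal (\<phi> x)"] by simp
qed

lemma conjugate_le:
  assumes "\<And>x. \<phi> x < \<infinity> \<Longrightarrow> ereal (t * x - F x) \<le> c"
  shows "conjugate \<phi> t \<le> c"
  unfolding conjugate_def
proof (rule SUP_least)
  fix x
  show "ereal (t * x) - enn2ereal (\<phi> x) \<le> c"
  proof (cases "\<phi> x < \<infinity>")
    case True
    then show ?thesis using assms[OF True] enn2ereal_phi[OF True] by simp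
  next
    case False
    then have "\<phi> x = top" by (simp add: not_less top_unique)
    then show ?thesis by simp
  qed
qed

lemma conjugate_ge_self: "ereal t \<le> conjugate \<phi> t"
  using conjugate_ge[of 1 t] by simp

text \<open>A jump of the derivative over the level \<open>t\<close> is excluded by the intermediate value property.\<close>
lemma psi_interior_D:
  assumes p: "\<psi> t = ereal p" and i: "p \<in> interior_dom"
  shows "D p = t"
proof (rule ccontr)
  assume "D p \<noteq> t"
  then consider "D p < t" | "t < D p" by linarith
  then show False
  proof cases
    case 1
    obtain w where w: "ereal p < ereal w" "ereal w < dom_upper \<phi>" using i ereal_dense_real by blast
    then have wi: "w \<in> interior_dom" using i by (intro interiorI[of "dom_lower \<phi>" w "dom_upper \<phi>"]) (auto intro: less_trans)
    then have "t < D w" using D_greater[of w t] p w by simp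
    then obtain x where x: "p < x" "x < w" "D x = t"
      using D_intermediate[OF i wi _ 1] w by auto
    then have "x \<in> interior_dom" using interior_between[OF i wi] by simp
    then show False using D_greater[of x t] p x by simp
  next
    case 2
    obtain w where w: "dom_lower \<phi> < ereal w" "ereal w < ereal p" using i ereal_dense_real by blast
    then have wi: "w \<in> interior_dom" using i by (intro interiorI[of "dom_lower \<phi>" w "ereal p"]) auto
    then have "D w < t" using D_less[of w t] p w by simp
    then obtain x where x: "w < x" "x < p" "D x = t"
      using D_intermediate[OF wi i _ _ 2] w by auto
    then have "x \<in> interior_dom" using interior_between[OF wi i] by simp
    then show False using D_less[of x t] p x by simp
  qed
qed

text \<open>How closedness enters: an inequality between values of \<open>t z - F z\<close> passes to the limit at an endpoint
  \<open>p\<close> of the domain, and in particular \<open>\<phi>\<close> is finite there.\<close>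
lemma le_at_boundary:
  assumes lim: "(\<phi> \<longlongrightarrow> \<phi> p) G" and G: "G \<noteq> bot" "(id \<longlongrightarrow> p) G"
    and ev: "\<forall>\<^sub>F z in G. \<phi> z < \<infinity> \<and> t * x - F x \<le> t * z - F z"
  shows "\<phi> p < \<infinity> \<and> t * x - F x \<le> t * p - F p"
proof -
  let ?u = "\<lambda>z. F x - t * x + t * z"
  have u: "(?u \<longlongrightarrow> ?u p) G"
    using G(2) unfolding id_def by (intro tendsto_intros)
  have F0: "0 \<le> F z" for z by simp
  have "\<forall>\<^sub>F z in G. 0 \<le> ?u z"
    using ev by (rule eventually_mono) (use F0 in \<open>smt (verit)\<close>)
  then have pos: "0 \<le> ?u p" by (rule tendsto_lowerbound[OF u _ G(1)])
  have "\<forall>\<^sub>F z in G. \<phi> z \<le> ennreal (?u z)"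
    using ev
  proof (rule eventually_mono)
    fix z assume z: "\<phi> z < \<infinity> \<and> t * x - F x \<le> t * z - F z"
    then have "ennreal (F z) \<le> ennreal (?u z)" by (intro ennreal_leI) linarith
    then show "\<phi> z \<le> ennreal (?u z)" using phi_eq[of z] z by simp
  qed
  then have le: "\<phi> p \<le> ennreal (?u p)"
    by (rule tendsto_le[OF G(1) tendsto_ennrealI[OF u] lim])
  then have "\<phi> p < \<infinity>" by (simp add: le_less_trans)
  moreover have "F p \<le> ?u p" using pos le by (rule enn2real_leI)
  ultimately show ?thesis by simp
qed

text \<open>At an interior point \<open>p\<close> this is the tangent inequality with slope \<open>D p = t\<close>. If \<open>p\<close> is an
  endpoint, the tangents at interior points \<open>z\<close> between \<open>p\<close> and \<open>x\<close> show that \<open>t z - F z\<close> is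
  at least \<open>t x - F x\<close>, and one lets \<open>z\<close> tend to \<open>p\<close>.\<close>
lemma psi_maximizes:
  assumes p: "\<psi> t = ereal p" and x: "\<phi> x < \<infinity>"
  shows "\<phi> p < \<infinity> \<and> t * x - F x \<le> t * p - F p"
proof (cases "x = p \<or> p \<in> interior_dom")
  case True
  then show ?thesis
  proof
    assume i: "p \<in> interior_dom"
    have "F p + t * (x - p) \<le> F x"
      using tangent_le[OF i x] psi_interior_D[OF p i] by simp
    then show ?thesis using phi_interior_finite[OF i] by (simp add: algebra_simps)
  qed (use x in auto)
next
  case False
  have "ereal p = dom_lower \<phi> \<or> ereal p = dom_upper \<phi>"
    using psi_bounds[of t] False p by (auto simp: less_le)
  then show ?thesis
  proof
    assume a: "ereal p = dom_lower \<phi>"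
    then have "p < x" using dom_bounds_real[OF x] False by (auto simp: a[symmetric])
    moreover have "ereal p < dom_upper \<phi>" using a dom_bounds by (auto intro: less_trans)
    ultimately have "ereal p < min (ereal x) (dom_upper \<phi>)" by simp
    then obtain c where c: "ereal p < ereal c" "ereal c < min (ereal x) (dom_upper \<phi>)"
      using ereal_dense_real by blast
    have "\<phi> z < \<infinity> \<and> t * x - F x \<le> t * z - F z" if z: "p < z" "z < c" for z
    proof -
      have i: "z \<in> interior_dom"
        using z c by (intro interiorI[of "ereal p" z "ereal c"]) (use z c in \<open>simp_all add: a[symmetric] less_imp_le\<close>)
      have "F z + D z * (x - z) \<le> F x" by (rule tangent_le[OF i x])
      moreover have "t * (x - z) \<le> D z * (x - z)"
        using D_greater[OF i, of t] p z c by (intro mult_right_mono) auto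
      ultimately show ?thesis using phi_interior_finite[OF i] by (simp add: algebra_simps)
    qed
    then have "\<forall>\<^sub>F z in at_right p. \<phi> z < \<infinity> \<and> t * x - F x \<le> t * z - F z"
      unfolding eventually_at_right_field using c by auto
    moreover have "(\<phi> \<longlongrightarrow> \<phi> p) (at_right p)"
      using divergence_function a by (simp add: divergence_function_def closed_fun_def)
    ultimately show ?thesis by (intro le_at_boundary[where G = "at_right p"]) (auto simp: id_def)
  next
    assume b: "ereal p = dom_upper \<phi>"
    then have "x < p" using dom_bounds_real[OF x] False by (auto simp: b[symmetric])
    moreover have "dom_lower \<phi> < ereal p" using b dom_bounds by (auto intro: less_trans)
    ultimately have "max (ereal x) (dom_lower \<phi>) < ereal p" by simp
    then obtain c where c: "max (ereal x) (dom_lower \<phi>) < ereal c" "ereal c < ereal p"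
      using ereal_dense_real by blast
    have "\<phi> z < \<infinity> \<and> t * x - F x \<le> t * z - F z" if z: "c < z" "z < p" for z
    proof -
      have i: "z \<in> interior_dom"
        using z c by (intro interiorI[of "ereal c" z "ereal p"]) (use z c in \<open>simp_all add: b[symmetric] less_imp_le\<close>)
      have "F z + D z * (x - z) \<le> F x" by (rule tangent_le[OF i x])
      moreover have "t * (x - z) \<le> D z * (x - z)"
        using D_less[OF i, of t] p z c by (intro mult_right_mono_neg) auto
      ultimately show ?thesis using phi_interior_finite[OF i] by (simp add: algebra_simps)
    qed
    then have "\<forall>\<^sub>F z in at_left p. \<phi> z < \<infinity> \<and> t * x - F x \<le> t * z - F z"
      unfolding eventually_at_left_field using c by auto
    moreover have "(\<phi> \<longlongrightarrow> \<phi> p) (at_left p)"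
      using divergence_function b by (simp add: divergence_function_def closed_fun_def)
    ultimately show ?thesis by (intro le_at_boundary[where G = "at_left p"]) (auto simp: id_def)
  qed
qed

text \<open>If \<open>\<psi> t \<noteq> p\<close>, an interior point \<open>y\<close> strictly between them is better than \<open>p\<close>: at \<open>y\<close> the slope
  of \<open>t x - F x\<close> points away from \<open>p\<close>.\<close>
lemma psi_unique_maximizer:
  assumes p: "\<phi> p < \<infinity>" and max: "\<And>x. x \<in> interior_dom \<Longrightarrow> t * x - F x \<le> t * p - F p"
  shows "\<psi> t = ereal p"
proof (rule ccontr)
  assume "\<psi> t \<noteq> ereal p"
  then consider "\<psi> t < ereal p" | "ereal p < \<psi> t" by (auto simp: neq_iff)
  then show False
  proof cases
    case 1
    then obtain y where y: "\<psi> t < ereal y" "ereal y < ereal p" using ereal_dense_real by blast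
    then have i: "y \<in> interior_dom"
      using dom_bounds_real[OF p] psi_bounds by (intro interiorI[of "\<psi> t" y "ereal p"]) auto
    have "t * (p - y) < D y * (p - y)"
      using D_greater[OF i y(1)] y by simp
    then show False
      using tangent_le[OF i p] max[OF i] by (simp add: algebra_simps)
  next
    case 2
    then obtain y where y: "ereal p < ereal y" "ereal y < \<psi> t" using ereal_dense_real by blast
    then have i: "y \<in> interior_dom"
      using dom_bounds_real[OF p] psi_bounds by (intro interiorI[of "ereal p" y "\<psi> t"]) auto
    have "t * (p - y) < D y * (p - y)"
      using D_less[OF i y(2)] y by simp
    then show False
      using tangent_le[OF i p] max[OF i] by (simp add: algebra_simps)
  qed
qed

text \<open>The equality case of the Young inequality.\<close>
lemma psi_eq_iff:
  "\<psi> t = ereal p \<longleftrightarrow> \<phi> p < \<infinity> \<and> conjugate \<phi> t = ereal (t * p - F p)"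
proof
  assume p: "\<psi> t = ereal p"
  then have fin: "\<phi> p < \<infinity>" using psi_maximizes[of t p 1] by simp
  moreover have "conjugate \<phi> t \<le> ereal (t * p - F p)"
    using psi_maximizes[OF p] by (intro conjugate_le) simp
  ultimately show "\<phi> p < \<infinity> \<and> conjugate \<phi> t = ereal (t * p - F p)"
    using conjugate_ge[OF fin, of t] by (auto intro: antisym)
next
  assume p: "\<phi> p < \<infinity> \<and> conjugate \<phi> t = ereal (t * p - F p)"
  then have "t * x - F x \<le> t * p - F p" if "x \<in> interior_dom" for x
    using conjugate_ge[OF phi_interior_finite[OF that], of t] by simp
  then show "\<psi> t = ereal p" using p by (intro psi_unique_maximizer) auto
qed

text \<open>An interior point \<open>z\<close> of the domain below \<open>\<psi> t\<close> satisfies \<open>D z < t\<close>; this persists for nearby \<open>s\<close> and forces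
  \<open>z \<le> \<psi> s\<close>. The other side is symmetric.\<close>
lemma isCont_psi: "isCont \<psi> t"
  unfolding isCont_def
proof (rule order_tendstoI)
  fix c assume "c < \<psi> t"
  show "\<forall>\<^sub>F s in at t. c < \<psi> s"
  proof (cases "c < dom_lower \<phi>")
    case True
    then show ?thesis using less_le_trans[OF True psi_bounds(1)] by simp
  next
    case False
    obtain y z where yz: "c < ereal y" "ereal y < ereal z" "ereal z < \<psi> t"
      using \<open>c < \<psi> t\<close> ereal_dense_real by metis
    then have i: "z \<in> interior_dom"
      using False psi_bounds by (intro interiorI[of "ereal y" z "\<psi> t"]) auto
    have "c < \<psi> s" if "D z < s" for s
    proof (rule ccontr)
      assume "\<not> c < \<psi> s"
      then have "\<psi> s < ereal z" using le_less_trans[OF _ less_trans[OF yz(1,2)]] by simp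
      then show False using D_greater[OF i, of s] that by simp
    qed
    moreover have "\<forall>\<^sub>F s in at t. D z < s"
      using D_less[OF i yz(3)] by (rule order_tendstoD[OF tendsto_ident_at])
    ultimately show ?thesis by (auto elim: eventually_mono)
  qed
next
  fix c assume "\<psi> t < c"
  show "\<forall>\<^sub>F s in at t. \<psi> s < c"
  proof (cases "dom_upper \<phi> < c")
    case True
    then show ?thesis using le_less_trans[OF psi_bounds(2) True] by simp
  next
    case False
    obtain y z where yz: "\<psi> t < ereal z" "ereal z < ereal y" "ereal y < c"
      using \<open>\<psi> t < c\<close> ereal_dense_real by metis
    then have i: "z \<in> interior_dom"
      using False psi_bounds by (intro interiorI[of "\<psi> t" z "ereal y"]) auto
    have "\<psi> s < c" if "s < D z" for s
    proof (rule ccontr)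
      assume "\<not> \<psi> s < c"
      then have "ereal z < \<psi> s" using less_le_trans[OF less_trans[OF yz(2,3)]] by simp
      then show False using D_less[OF i, of s] that by simp
    qed
    moreover have "\<forall>\<^sub>F s in at t. s < D z"
      using D_greater[OF i yz(1)] by (rule order_tendstoD[OF tendsto_ident_at])
    ultimately show ?thesis by (auto elim: eventually_mono)
  qed
qed

text \<open>If \<open>\<psi> t = \<infinity>\<close>, all slopes of \<open>\<phi>\<close> are below \<open>t\<close>, so \<open>\<phi> y \<le> t (y - 1)\<close> for \<open>y \<ge> 1\<close> and
  \<open>(t + e) y - \<phi> y\<close> is unbounded. The value \<open>- \<infinity>\<close> is excluded in the same way by \<open>t - e\<close>.\<close>
lemma psi_finite:
  assumes e: "e > 0" and fin: "conjugate \<phi> (t + e) < \<infinity>" "conjugate \<phi> (t - e) < \<infinity>"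
  shows "\<bar>\<psi> t\<bar> \<noteq> \<infinity>"
proof -
  have "\<psi> t \<noteq> \<infinity>"
  proof
    assume inf: "\<psi> t = \<infinity>"
    obtain d where d: "conjugate \<phi> (t + e) = ereal d"
      using fin(1) conjugate_ge_self[of "t + e"] by (cases "conjugate \<phi> (t + e)") auto
    have "e * y + t \<le> d" if y: "y \<ge> 1" for y
    proof -
      have b: "dom_upper \<phi> = \<infinity>" using psi_bounds(2)[of t] inf by simp
      have i: "y \<in> interior_dom"
        using y b less_le_trans[OF dom_bounds(1), of "ereal y"] by simp
      have "F y + D y * (1 - y) \<le> 0" using tangent_le[OF i, of 1] by simp
      moreover have "D y * (y - 1) \<le> t * (y - 1)"
        using D_less[OF i, of t] inf y by (intro mult_right_mono) auto
      ultimately have "F y \<le> t * (y - 1)" by (simp add: algebra_simps)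
      moreover have "(t + e) * y - F y \<le> d"
        using conjugate_ge[OF phi_interior_finite[OF i], of "t + e"] d by simp
      ultimately show ?thesis by (simp add: algebra_simps)
    qed
    then show False using not_bounded_linear[OF e] by blast
  qed
  moreover have "\<psi> t \<noteq> - \<infinity>"
  proof
    assume inf: "\<psi> t = - \<infinity>"
    obtain d where d: "conjugate \<phi> (t - e) = ereal d"
      using fin(2) conjugate_ge_self[of "t - e"] by (cases "conjugate \<phi> (t - e)") auto
    have "e * y + t \<le> d" if y: "y \<ge> 1" for y
    proof -
      have a: "dom_lower \<phi> = - \<infinity>" using psi_bounds(1)[of t] inf by simp
      have i: "- y \<in> interior_dom"
        using y a le_less_trans[OF _ dom_bounds(2), of "ereal (- y)"] by simp
      have "F (- y) + D (- y) * (1 + y) \<le> 0" using tangent_le[OF i, of 1] by simp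
      moreover have "t * (1 + y) \<le> D (- y) * (1 + y)"
        using D_greater[OF i, of t] inf y by (intro mult_right_mono) auto
      ultimately have "F (- y) \<le> - t * (1 + y)" by simp
      moreover have "(t - e) * (- y) - F (- y) \<le> d"
        using conjugate_ge[OF phi_interior_finite[OF i], of "t - e"] d by simp
      ultimately show ?thesis by (simp add: algebra_simps)
    qed
    then show False using not_bounded_linear[OF e] by blast
  qed
  ultimately show ?thesis by (cases "\<psi> t") auto
qed

text \<open>At a finite endpoint \<open>p = \<psi> t\<close> the number \<open>t\<close> would bound the slopes on the side where they are
  unbounded.\<close>
lemma essentially_smooth_psi_interior:
  assumes es: "essentially_smooth \<phi>" and p: "\<psi> t = ereal p"
  shows "p \<in> interior_dom"
proof -
  have "dom_lower \<phi> \<noteq> ereal p"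
  proof
    assume a: "dom_lower \<phi> = ereal p"
    have "ereal t \<le> phi_deriv \<phi> (dom_lower \<phi>)"
      unfolding phi_deriv_lower
      using D_greater p a by (intro INF_greatest) (auto intro: less_imp_le)
    moreover have "phi_deriv \<phi> (dom_lower \<phi>) = - \<infinity>"
      using es a by (simp add: essentially_smooth_def)
    ultimately show False by simp
  qed
  moreover have "dom_upper \<phi> \<noteq> ereal p"
  proof
    assume b: "dom_upper \<phi> = ereal p"
    have "phi_deriv \<phi> (dom_upper \<phi>) \<le> ereal t"
      unfolding phi_deriv_upper
      using D_less p b by (intro SUP_least) (auto intro: less_imp_le)
    moreover have "phi_deriv \<phi> (dom_upper \<phi>) = \<infinity>"
      using es b by (simp add: essentially_smooth_def)
    ultimately show False by simp
  qed
  ultimately show ?thesis using psi_bounds[of t] p by (auto simp: less_le)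
qed

lemma psi_inj:
  assumes "essentially_smooth \<phi>" "\<psi> s = ereal p" "\<psi> t = ereal p"
  shows "s = t"
  using psi_interior_D essentially_smooth_psi_interior assms by metis

text \<open>The strict sublevel sets of a convex function are intervals.\<close>
lemma measurable_phi [measurable]: "\<phi> \<in> borel_measurable borel"
proof (rule borel_measurableI_less)
  fix c
  have "convex {x. \<phi> x < c}"
  proof (rule convexI)
    fix x y u v :: real assume xy: "x \<in> {x. \<phi> x < c}" "y \<in> {x. \<phi> x < c}"
      and uv: "0 \<le> u" "0 \<le> v" "u + v = 1"
    have u: "u = 1 - v" using uv by simp
    have "\<phi> (u *\<^sub>R x + v *\<^sub>R y) \<le> ennreal u * \<phi> x + ennreal v * \<phi> y"
      using phi_convex[of v x y] uv unfolding u by simp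
    also have "\<dots> \<le> ennreal u * max (\<phi> x) (\<phi> y) + ennreal v * max (\<phi> x) (\<phi> y)"
      by (intro add_mono mult_left_mono) auto
    also have "\<dots> = max (\<phi> x) (\<phi> y)"
      using uv by (simp add: distrib_right[symmetric] ennreal_plus[symmetric] del: ennreal_plus)
    also have "\<dots> < c" using xy by simp
    finally show "u *\<^sub>R x + v *\<^sub>R y \<in> {x. \<phi> x < c}" by simp
  qed
  then show "{x \<in> space borel. \<phi> x < c} \<in> sets borel"
    using real_interval_borel_measurable[of "{x. \<phi> x < c}"] by (simp add: is_interval_convex_1)
qed

text \<open>The conjugate is a supremum of continuous functions, so the sets where it exceeds a level are
  open although the supremum is uncountable.\<close>
lemma measurable_conjugate [measurable]: "conjugate \<phi> \<in> borel_measurable borel"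
proof (rule borel_measurableI_greater)
  fix c
  have "{t. c < conjugate \<phi> t} = (\<Union>x \<in> {x. \<phi> x < \<infinity>}. {t. c < ereal (t * x - F x)})"
  proof (intro set_eqI iffI)
    fix t assume "t \<in> {t. c < conjugate \<phi> t}"
    then have "\<not> conjugate \<phi> t \<le> c" by simp
    then obtain x where "\<phi> x < \<infinity>" "\<not> ereal (t * x - F x) \<le> c" using conjugate_le by blast
    then show "t \<in> (\<Union>x \<in> {x. \<phi> x < \<infinity>}. {t. c < ereal (t * x - F x)})" by auto
  next
    fix t assume "t \<in> (\<Union>x \<in> {x. \<phi> x < \<infinity>}. {t. c < ereal (t * x - F x)})"
    then show "t \<in> {t. c < conjugate \<phi> t}" using conjugate_ge by (auto intro: less_le_trans)
  qed
  moreover have "open {t. c < ereal (t * x - F x)}" for x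
    by (intro open_Collect_less continuous_intros)
  ultimately show "{t \<in> space borel. c < conjugate \<phi> t} \<in> sets borel"
    by (auto intro!: borel_open open_UN)
qed

lemma measurable_psi [measurable]: "\<psi> \<in> borel_measurable borel"
  by (intro borel_measurable_continuous_onI continuous_at_imp_continuous_on ballI isCont_psi)

text \<open>\<open>\<psi>\<close> is a subgradient of the conjugate: the first bound uses it at \<open>s\<close>, the second one at \<open>t\<close>.\<close>
lemma conjugate_difference_bounds:
  assumes p: "\<psi> s = ereal p" and q: "\<psi> t = ereal q"
    and c: "conjugate \<phi> s = ereal c" and d: "conjugate \<phi> t = ereal d"
  shows "p * (t - s) \<le> d - c" "d - c \<le> q * (t - s)"
proof -
  have fin: "\<phi> p < \<infinity>" "\<phi> q < \<infinity>" "c = s * p - F p" "d = t * q - F q"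
    using p q c d by (auto simp: psi_eq_iff)
  then have "t * p - F p \<le> d" "s * q - F q \<le> c"
    using conjugate_ge[OF fin(1), of t] conjugate_ge[OF fin(2), of s] c d by auto
  then show "p * (t - s) \<le> d - c" "d - c \<le> q * (t - s)"
    using fin by (auto simp: algebra_simps)
qed

lemma conjugate_convex:
  assumes c: "conjugate \<phi> s = ereal c" and d: "conjugate \<phi> t = ereal d"
    and e: "conjugate \<phi> ((1 - \<theta>) * s + \<theta> * t) = ereal e" and \<theta>: "0 \<le> \<theta>" "\<theta> \<le> 1"
  shows "e \<le> (1 - \<theta>) * c + \<theta> * d"
proof -
  have "conjugate \<phi> ((1 - \<theta>) * s + \<theta> * t) \<le> ereal ((1 - \<theta>) * c + \<theta> * d)"
  proof (rule conjugate_le)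
    fix x assume x: "\<phi> x < \<infinity>"
    have "s * x - F x \<le> c" "t * x - F x \<le> d"
      using conjugate_ge[OF x, of s] conjugate_ge[OF x, of t] c d by auto
    then have "(1 - \<theta>) * (s * x - F x) + \<theta> * (t * x - F x) \<le> (1 - \<theta>) * c + \<theta> * d"
      using \<theta> by (intro add_mono mult_left_mono) auto
    then show "ereal (((1 - \<theta>) * s + \<theta> * t) * x - F x) \<le> ereal ((1 - \<theta>) * c + \<theta> * d)"
      by (simp add: algebra_simps)
  qed
  then show ?thesis using e by simp
qed

end

section \<open>Weak duality\<close>

lemma ext_integral_real:
  assumes r: "integrable P r" and eq: "AE x in P. c x = ereal (r x)"
  shows "ext_integral P c = ereal (LINT x|P. r x)"
proof -
  have [simp]: "e2ennreal (ereal z) = ennreal z" for z by (simp add: ennreal.abs_eq e2ennreal_def)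
  have "(\<integral>\<^sup>+ x. e2ennreal (c x) \<partial>P) = (\<integral>\<^sup>+ x. ennreal (r x) \<partial>P)"
    and "(\<integral>\<^sup>+ x. e2ennreal (- c x) \<partial>P) = (\<integral>\<^sup>+ x. ennreal (- r x) \<partial>P)"
    using eq by (auto intro!: nn_integral_cong_AE)
  moreover have "(\<integral>\<^sup>+ x. ennreal (r x) \<partial>P) \<noteq> \<infinity>" "(\<integral>\<^sup>+ x. ennreal (- r x) \<partial>P) \<noteq> \<infinity>"
    using r by (auto simp: real_integrable_def)
  ultimately show ?thesis
    unfolding ext_integral_def real_lebesgue_integral_def[OF r]
    by (metis enn2ereal_ennreal enn2real_nonneg ennreal_enn2real ereal_minus(1) infinity_ennreal_def less_top)
qed

text \<open>An integrable minorant rules out every pathology of the extended integral except the value \<open>\<infinity>\<close>.\<close>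
lemma ext_integral_cases:
  assumes s: "integrable P s" and c: "c \<in> borel_measurable P" and le: "AE x in P. ereal (s x) \<le> c x"
  obtains "ext_integral P c = \<infinity>"
  | r where "integrable P r" "AE x in P. c x = ereal (r x)"
proof (cases "(\<integral>\<^sup>+ x. e2ennreal (c x) \<partial>P) = \<infinity>")
  case True
  then show ?thesis by (intro that(1)) (simp add: ext_integral_def)
next
  case False
  have [simp]: "e2ennreal (ereal z) = ennreal z" for z by (simp add: ennreal.abs_eq e2ennreal_def)
  note [measurable] = c
  have "AE x in P. e2ennreal (c x) \<noteq> \<infinity>"
    using False by (intro nn_integral_noteq_infinite) auto
  with le have eq: "AE x in P. c x = ereal (real_of_ereal (c x))"
  proof eventually_elim
    case (elim x)
    then show ?case by (cases "c x") auto
  qed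
  have m: "(\<lambda>x. real_of_ereal (c x)) \<in> borel_measurable P" by measurable
  have "(\<integral>\<^sup>+ x. ennreal (real_of_ereal (c x)) \<partial>P) = (\<integral>\<^sup>+ x. e2ennreal (c x) \<partial>P)"
  proof (rule nn_integral_cong_AE)
    show "AE x in P. ennreal (real_of_ereal (c x)) = e2ennreal (c x)"
      using eq
    proof eventually_elim
      case (elim x)
      then show ?case by (cases "c x") auto
    qed
  qed
  moreover have "(\<integral>\<^sup>+ x. ennreal (- real_of_ereal (c x)) \<partial>P) \<le> (\<integral>\<^sup>+ x. ennreal (- s x) \<partial>P)"
  proof (rule nn_integral_mono_AE)
    show "AE x in P. ennreal (- real_of_ereal (c x)) \<le> ennreal (- s x)"
      using eq le
    proof eventually_elim
      case (elim x)
      then show ?case by (cases "c x") (auto intro!: ennreal_leI)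
    qed
  qed
  moreover have "(\<integral>\<^sup>+ x. ennreal (- s x) \<partial>P) \<noteq> \<infinity>" using s by (auto simp: real_integrable_def)
  ultimately have "integrable P (\<lambda>x. real_of_ereal (c x))"
    using False m by (auto simp: real_integrable_def top_unique)
  then show ?thesis using that(2) eq by blast
qed

lemma inner_gvec: "inner w (gvec g x) = fst w + (\<Sum>i\<in>UNIV. snd w $ i * g i x)"
  by (simp add: gvec_def inner_prod_def inner_vec_def)

locale dual_problem = smooth_divergence \<phi> + prob_space P
  for \<phi> :: "real \<Rightarrow> ennreal" and P :: "'a measure" +
  fixes g :: "'l::finite \<Rightarrow> 'a \<Rightarrow> real"
  assumes measurable_g [measurable]: "\<And>i. g i \<in> borel_measurable P"
begin

abbreviation "lin w x \<equiv> inner w (gvec g x)"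

abbreviation "dens \<equiv> dual_density \<phi> g"

lemma measurable_gvec [measurable]: "gvec g \<in> borel_measurable P"
  unfolding borel_measurable_euclidean_space[of "gvec g"] inner_commute[of "gvec g _"] inner_gvec
  by measurable

lemma integrable_gvec_iff:
  "integrable P (\<lambda>x. f x *\<^sub>R gvec g x) \<longleftrightarrow> (\<forall>w. integrable P (\<lambda>x. f x * lin w x))"
proof
  assume "integrable P (\<lambda>x. f x *\<^sub>R gvec g x)"
  then have "integrable P (\<lambda>x. inner w (f x *\<^sub>R gvec g x))" for w by (intro integrable_inner_right) auto
  then show "\<forall>w. integrable P (\<lambda>x. f x * lin w x)" by simp
next
  assume "\<forall>w. integrable P (\<lambda>x. f x * lin w x)"
  then have "integrable P (\<lambda>x. \<Sum>b\<in>Basis. (f x * lin b x) *\<^sub>R b)"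
    by (intro Bochner_Integration.integrable_sum integrable_scaleR_left) auto
  also have "(\<lambda>x. \<Sum>b\<in>Basis. (f x * lin b x) *\<^sub>R b) = (\<lambda>x. f x *\<^sub>R gvec g x)"
    using euclidean_representation[of "f _ *\<^sub>R gvec g _"] by (simp add: inner_commute fun_eq_iff)
  finally show "integrable P (\<lambda>x. f x *\<^sub>R gvec g x)" .
qed

text \<open>The densities of the admissible measures of finite divergence, with all constraints collected
  in one vector equation.\<close>
definition feasible :: "('a \<Rightarrow> real) \<Rightarrow> bool" where
  "feasible f \<longleftrightarrow> (\<integral>\<^sup>+ x. \<phi> (f x) \<partial>P) < \<infinity> \<and> integrable P (\<lambda>x. f x *\<^sub>R gvec g x) \<and>
     (LINT x|P. f x *\<^sub>R gvec g x) = (1, 0)"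

lemma feasible_lin:
  assumes "feasible f"
  shows "integrable P (\<lambda>x. f x * lin w x)" "(LINT x|P. f x * lin w x) = fst w"
proof -
  have int: "integrable P (\<lambda>x. f x *\<^sub>R gvec g x)" using assms by (simp add: feasible_def)
  then show "integrable P (\<lambda>x. f x * lin w x)" unfolding integrable_gvec_iff by blast
  have "(LINT x|P. f x * lin w x) = (LINT x|P. inner w (f x *\<^sub>R gvec g x))" by simp
  also have "\<dots> = inner w (LINT x|P. f x *\<^sub>R gvec g x)"
    using int by (intro integral_inner_right) auto
  finally show "(LINT x|P. f x * lin w x) = fst w"
    using assms by (simp add: feasible_def inner_prod_def)
qed

lemma feasible_integrable: "feasible f \<Longrightarrow> integrable P f"
  using feasible_lin(1)[of f "(1, 0)"] by (simp add: gvec_def)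

lemma feasible_F:
  assumes f: "feasible f"
  shows "AE x in P. \<phi> (f x) < \<infinity>" "integrable P (\<lambda>x. F (f x))"
    "(\<integral>\<^sup>+ x. \<phi> (f x) \<partial>P) = ennreal (LINT x|P. F (f x))"
proof -
  have [measurable]: "f \<in> borel_measurable P" using feasible_integrable[OF f] by auto
  have fin: "(\<integral>\<^sup>+ x. \<phi> (f x) \<partial>P) \<noteq> \<infinity>" using f by (auto simp: feasible_def)
  show ae: "AE x in P. \<phi> (f x) < \<infinity>"
    using nn_integral_noteq_infinite[OF _ fin] by (simp add: less_top)
  have eq: "(\<integral>\<^sup>+ x. \<phi> (f x) \<partial>P) = (\<integral>\<^sup>+ x. ennreal (F (f x)) \<partial>P)"
  proof (rule nn_integral_cong_AE)
    show "AE x in P. \<phi> (f x) = ennreal (F (f x))"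
      using ae by eventually_elim (rule phi_eq)
  qed
  show int: "integrable P (\<lambda>x. F (f x))"
    using fin unfolding eq by (intro integrableI_nonneg) (auto simp: less_top)
  show "(\<integral>\<^sup>+ x. \<phi> (f x) \<partial>P) = ennreal (LINT x|P. F (f x))"
    unfolding eq by (rule nn_integral_eq_integral[OF int]) auto
qed

text \<open>The integrated left-hand side of the Young inequality depends on \<open>w\<close> only through its first
  component. It also supplies the integrable minorant for the conjugate.\<close>
lemma lagrangian_integral:
  assumes f: "feasible f"
  shows "integrable P (\<lambda>x. f x * lin w x - F (f x))"
    and "(LINT x|P. f x * lin w x - F (f x)) = fst w - (LINT x|P. F (f x))"
    and "AE x in P. ereal (f x * lin w x - F (f x)) \<le> conjugate \<phi> (lin w x)"
proof -
  show "integrable P (\<lambda>x. f x * lin w x - F (f x))"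
    "(LINT x|P. f x * lin w x - F (f x)) = fst w - (LINT x|P. F (f x))"
    using feasible_lin[OF f] feasible_F(2)[OF f] by auto
  show "AE x in P. ereal (f x * lin w x - F (f x)) \<le> conjugate \<phi> (lin w x)"
    using feasible_F(1)[OF f] conjugate_ge by (auto simp: mult.commute)
qed

lemma dual_objective_real:
  assumes "integrable P r" "AE x in P. conjugate \<phi> (lin w x) = ereal (r x)"
  shows "dual_objective \<phi> P g w = ereal (fst w - (LINT x|P. r x))"
  unfolding dual_objective_def ext_integral_real[OF assms] by simp

lemma conj_lin_measurable: "(\<lambda>x. conjugate \<phi> (lin w x)) \<in> borel_measurable P"
  by measurable

lemma dual_objective_cases:
  assumes f: "feasible f"
  obtains "dual_objective \<phi> P g w = - \<infinity>"
  | r where "integrable P r" "AE x in P. conjugate \<phi> (lin w x) = ereal (r x)"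
    "AE x in P. f x * lin w x - F (f x) \<le> r x"
proof -
  note s = lagrangian_integral[OF f, of w]
  show ?thesis
  proof (rule ext_integral_cases[OF s(1) conj_lin_measurable s(3)])
    assume "ext_integral P (\<lambda>x. conjugate \<phi> (lin w x)) = \<infinity>"
    then show ?thesis by (intro that(1)) (simp add: dual_objective_def)
  next
    fix r assume r: "integrable P r" "AE x in P. conjugate \<phi> (lin w x) = ereal (r x)"
    moreover have "AE x in P. f x * lin w x - F (f x) \<le> r x"
      using r(2) s(3) by eventually_elim simp
    ultimately show ?thesis by (rule that(2))
  qed
qed

lemma weak_duality:
  assumes f: "feasible f"
  shows "dual_objective \<phi> P g w \<le> ereal (LINT x|P. F (f x))"
proof (rule dual_objective_cases[OF f, of w])
  fix r assume r: "integrable P r" "AE x in P. conjugate \<phi> (lin w x) = ereal (r x)"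
    "AE x in P. f x * lin w x - F (f x) \<le> r x"
  show ?thesis
    unfolding dual_objective_real[OF r(1,2)]
    using integral_mono_AE[OF lagrangian_integral(1)[OF f] r(1) r(3)] lagrangian_integral(2)[OF f, of w]
    by simp
qed simp

text \<open>Equality of the integrals in the Young inequality means equality almost everywhere.\<close>
lemma no_duality_gap_iff:
  assumes f: "feasible f"
  shows "dual_objective \<phi> P g w = ereal (LINT x|P. F (f x)) \<longleftrightarrow> (AE x in P. \<psi> (lin w x) = ereal (f x))"
proof
  assume "AE x in P. \<psi> (lin w x) = ereal (f x)"
  then have "AE x in P. conjugate \<phi> (lin w x) = ereal (f x * lin w x - F (f x))"
    by eventually_elim (simp add: psi_eq_iff mult.commute)
  from dual_objective_real[OF lagrangian_integral(1)[OF f] this] lagrangian_integral(2)[OF f, of w]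
  show "dual_objective \<phi> P g w = ereal (LINT x|P. F (f x))" by simp
next
  assume eq: "dual_objective \<phi> P g w = ereal (LINT x|P. F (f x))"
  show "AE x in P. \<psi> (lin w x) = ereal (f x)"
  proof (rule dual_objective_cases[OF f, of w])
    fix r assume r: "integrable P r" "AE x in P. conjugate \<phi> (lin w x) = ereal (r x)"
      "AE x in P. f x * lin w x - F (f x) \<le> r x"
    let ?s = "\<lambda>x. f x * lin w x - F (f x)"
    have "(LINT x|P. r x - ?s x) = 0"
      using eq[unfolded dual_objective_real[OF r(1,2)]] lagrangian_integral[OF f, of w] r(1) by simp
    then have "AE x in P. r x - ?s x = 0"
      using r lagrangian_integral(1)[OF f, of w] by (subst integral_nonneg_eq_0_iff_AE[symmetric]) auto
    with r(2) feasible_F(1)[OF f] show ?thesis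
      by eventually_elim (simp add: psi_eq_iff mult.commute)
  qed (use eq in simp)
qed

lemma in_constraint_set_iff:
  assumes f: "integrable P f"
  shows "signed_density P f \<in> constraint_set P g \<longleftrightarrow>
    integrable P (\<lambda>x. f x *\<^sub>R gvec g x) \<and> (LINT x|P. f x *\<^sub>R gvec g x) = (1, 0)"
proof -
  let ?y = "\<lambda>x. f x *\<^sub>R gvec g x"
  have bl: "bounded_linear (\<lambda>z :: real \<times> (real ^ 'l). snd z $ i)" for i
    by (rule bounded_linear_compose[OF bounded_linear_vec_nth bounded_linear_snd])
  have int: "integrable P ?y \<longleftrightarrow> (\<forall>i. integrable P (\<lambda>x. f x * g i x))"
  proof
    assume "integrable P ?y"
    then have "integrable P (\<lambda>x. snd (?y x) $ i)" for i
      by (rule integrable_bounded_linear[OF bl])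
    then show "\<forall>i. integrable P (\<lambda>x. f x * g i x)" by (simp add: gvec_def)
  next
    assume "\<forall>i. integrable P (\<lambda>x. f x * g i x)"
    then have "integrable P (\<lambda>x. fst w * f x + (\<Sum>i\<in>UNIV. snd w $ i * (f x * g i x)))" for w :: "real \<times> (real ^ 'l)"
      using f by (intro Bochner_Integration.integrable_add Bochner_Integration.integrable_sum integrable_mult_right) auto
    then show "integrable P ?y"
      unfolding integrable_gvec_iff inner_gvec by (simp add: algebra_simps sum_distrib_left)
  qed
  have "(LINT x|P. ?y x) = (1, 0) \<longleftrightarrow> (LINT x|P. f x) = 1 \<and> (\<forall>i. (LINT x|P. f x * g i x) = 0)"
    if y: "integrable P ?y"
  proof -
    have "fst (LINT x|P. ?y x) = (LINT x|P. f x)"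
      using integral_bounded_linear[OF bounded_linear_fst y] by (simp add: gvec_def)
    moreover have "snd (LINT x|P. ?y x) $ i = (LINT x|P. f x * g i x)" for i
      using integral_bounded_linear[OF bl y, of i] by (simp add: gvec_def)
    ultimately show ?thesis by (auto simp: prod_eq_iff vec_eq_iff)
  qed
  then show ?thesis
    unfolding signed_density_in_constraint_set_iff[where g = g, OF measurable_g f] using int by blast
qed

lemma divergence_finite_feasible:
  assumes R: "R \<in> constraint_set P g" and fin: "divergence \<phi> P R < \<infinity>"
  obtains h where "feasible h" "R = signed_density P h"
proof -
  have "R \<in> ac_signed_measures P" using R by (simp add: constraint_set_def)
  then obtain h where h: "integrable P h" "R = signed_density P h"
    using signed_Radon_Nikodym by blast
  then have "feasible h"
    using R fin in_constraint_set_iff[OF h(1)] divergence_signed_density[OF h(1), of \<phi>]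
    by (simp add: feasible_def)
  then show ?thesis using that h by blast
qed

lemma feasible_divergence:
  assumes f: "feasible f"
  shows "signed_density P f \<in> constraint_set P g"
    and "divergence \<phi> P (signed_density P f) = ennreal (LINT x|P. F (f x))"
  using f in_constraint_set_iff[OF feasible_integrable[OF f]]
    divergence_signed_density[OF feasible_integrable[OF f]] feasible_F(3)[OF f]
  by (auto simp: feasible_def)

text \<open>Almost sure finiteness of the extended density says that it agrees with its real version.\<close>
lemma moment_condition_iff:
  "moment_condition \<phi> P g v \<longleftrightarrow>
    feasible (dens v) \<and> (AE x in P. \<psi> (lin v x) = ereal (dens v x))"
proof -
  have "\<bar>dual_density_ext \<phi> g v x\<bar> \<noteq> \<infinity> \<longleftrightarrow> \<psi> (lin v x) = ereal (dens v x)" for x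
    unfolding dual_density_def dual_density_ext_def by (cases "\<psi> (lin v x)") auto
  then show ?thesis unfolding moment_condition_def feasible_def by auto
qed

section \<open>Optimality under the moment condition\<close>

context
  fixes v
  assumes mc: "moment_condition \<phi> P g v"
begin

lemma moment_density_feasible: "feasible (dens v)" and moment_density_psi: "AE x in P. \<psi> (lin v x) = ereal (dens v x)"
  using mc by (auto simp: moment_condition_iff)

lemma dual_value: "dual_objective \<phi> P g v = ereal (LINT x|P. F (dens v x))"
  using no_duality_gap_iff[OF moment_density_feasible] moment_density_psi by simp

lemma dual_sup: "(SUP w. dual_objective \<phi> P g w) = ereal (LINT x|P. F (dens v x))"
proof (rule antisym)
  show "(SUP w. dual_objective \<phi> P g w) \<le> ereal (LINT x|P. F (dens v x))"
    by (rule SUP_least) (rule weak_duality[OF moment_density_feasible])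
  show "ereal (LINT x|P. F (dens v x)) \<le> (SUP w. dual_objective \<phi> P g w)"
    unfolding dual_value[symmetric] by (rule SUP_upper) simp
qed

lemma moment_density_divergence_le:
  assumes R: "R \<in> constraint_set P g"
  shows "divergence \<phi> P (signed_density P (dens v)) \<le> divergence \<phi> P R"
proof (cases "divergence \<phi> P R < \<infinity>")
  case True
  then obtain h where h: "feasible h" "R = signed_density P h" using divergence_finite_feasible[OF R] by blast
  have "ereal (LINT x|P. F (dens v x)) \<le> ereal (LINT x|P. F (h x))"
    using weak_duality[OF h(1), of v] dual_value by simp
  then show ?thesis unfolding h(2) feasible_divergence(2)[OF moment_density_feasible] feasible_divergence(2)[OF h(1)]
    by (simp add: ennreal_leI)
qed (simp add: not_less top_unique)

lemma moment_density_is_projection: "is_projection \<phi> P (constraint_set P g) (signed_density P (dens v))"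
proof -
  have "(INF R\<in>constraint_set P g. divergence \<phi> P R) < \<infinity>"
    unfolding INF_less_iff using feasible_divergence[OF moment_density_feasible] by (intro bexI) auto
  then show ?thesis
    using feasible_divergence(1)[OF moment_density_feasible] moment_density_divergence_le by (simp add: is_projection_def)
qed

text \<open>A second projection has no duality gap with \<open>v\<close> either, so its density is also \<open>\<psi> (v\<^sup>T g)\<close>.\<close>
lemma projection_unique:
  assumes Q: "is_projection \<phi> P (constraint_set P g) Q"
  shows "Q = signed_density P (dens v)"
proof -
  have QC: "Q \<in> constraint_set P g" using Q by (simp add: is_projection_def)
  have le: "divergence \<phi> P Q \<le> ennreal (LINT x|P. F (dens v x))"
    using Q feasible_divergence[OF moment_density_feasible] by (auto simp: is_projection_def)
  then have "divergence \<phi> P Q < \<infinity>" by (simp add: le_less_trans)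
  then obtain h where h: "feasible h" "Q = signed_density P h" using divergence_finite_feasible[OF QC] by blast
  have "divergence \<phi> P Q = ennreal (LINT x|P. F (dens v x))"
    using le moment_density_divergence_le[OF QC] feasible_divergence(2)[OF moment_density_feasible] by auto
  then have "(LINT x|P. F (h x)) = (LINT x|P. F (dens v x))"
    unfolding h(2) feasible_divergence(2)[OF h(1)] by (subst (asm) ennreal_inj) auto
  then have "AE x in P. \<psi> (lin v x) = ereal (h x)"
    using no_duality_gap_iff[OF h(1), of v] dual_value by simp
  with moment_density_psi have "AE x in P. h x = dens v x" by eventually_elim simp
  then show ?thesis unfolding h(2)
    using feasible_integrable[OF h(1)] feasible_integrable[OF moment_density_feasible]
    by (intro signed_density_cong_AE) auto
qed

lemma primal_value:
  "(INF Q \<in> constraint_set P g. enn2ereal (divergence \<phi> P Q)) = ereal (LINT x|P. F (dens v x))"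
proof -
  have val: "enn2ereal (divergence \<phi> P (signed_density P (dens v))) = ereal (LINT x|P. F (dens v x))"
    unfolding feasible_divergence(2)[OF moment_density_feasible] by (intro enn2ereal_ennreal integral_nonneg_AE) auto
  show ?thesis
  proof (rule antisym)
    show "(INF Q \<in> constraint_set P g. enn2ereal (divergence \<phi> P Q)) \<le> ereal (LINT x|P. F (dens v x))"
      unfolding val[symmetric] by (rule INF_lower) (rule feasible_divergence(1)[OF moment_density_feasible])
    show "ereal (LINT x|P. F (dens v x)) \<le> (INF Q \<in> constraint_set P g. enn2ereal (divergence \<phi> P Q))"
      unfolding val[symmetric] by (intro INF_greatest) (simp add: moment_density_divergence_le less_eq_ennreal.rep_eq[symmetric])
  qed
qed

lemma dual_unique:
  assumes li: "lin_indep P g" and es: "essentially_smooth \<phi>" and w: "dual_optimal \<phi> P g w"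
  shows "w = v"
proof (rule ccontr)
  assume "w \<noteq> v"
  then have pos: "measure P {x \<in> space P. inner (w - v) (gvec g x) \<noteq> 0} > 0"
    using li unfolding lin_indep_def by (metis right_minus_eq)
  have "dual_objective \<phi> P g w = ereal (LINT x|P. F (dens v x))"
    using w dual_sup by (simp add: dual_optimal_def)
  then have "AE x in P. \<psi> (lin w x) = ereal (dens v x)" using no_duality_gap_iff[OF moment_density_feasible] by simp
  with moment_density_psi have "AE x in P. inner (w - v) (gvec g x) = 0"
  proof eventually_elim
    case (elim x)
    then show ?case using psi_inj[OF es, of "lin w x" "dens v x" "lin v x"] by (simp add: inner_diff_left)
  qed
  then have "measure P {x \<in> space P. inner (w - v) (gvec g x) \<noteq> 0} = 0"
    by (subst measure_eq_0_null_sets) (auto simp: AE_iff_null_sets)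
  with pos show False by simp
qed

end

section \<open>The first-order condition at an interior dual optimum\<close>

abbreviation "conj_fun w x \<equiv> real_of_ereal (conjugate \<phi> (lin w x))"

lemma conj_integrable:
  assumes w: "w \<in> conj_integrable_set \<phi> P g"
  shows "AE x in P. conjugate \<phi> (lin w x) = ereal (conj_fun w x)" "integrable P (conj_fun w)"
proof -
  have fin: "(\<integral>\<^sup>+ x. e2ennreal \<bar>conjugate \<phi> (lin w x)\<bar> \<partial>P) \<noteq> \<infinity>"
    using w by (auto simp: conj_integrable_set_def)
  have "AE x in P. e2ennreal \<bar>conjugate \<phi> (lin w x)\<bar> \<noteq> \<infinity>"
    using fin by (intro nn_integral_noteq_infinite) auto
  then show eq: "AE x in P. conjugate \<phi> (lin w x) = ereal (conj_fun w x)"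
  proof eventually_elim
    case (elim x)
    then show ?case by (cases "conjugate \<phi> (lin w x)") auto
  qed
  have "(\<integral>\<^sup>+ x. ennreal (norm (conj_fun w x)) \<partial>P) \<le> (\<integral>\<^sup>+ x. e2ennreal \<bar>conjugate \<phi> (lin w x)\<bar> \<partial>P)"
  proof (rule nn_integral_mono)
    fix x
    have [simp]: "e2ennreal (ereal z) = ennreal z" for z by (simp add: ennreal.abs_eq e2ennreal_def)
    show "ennreal (norm (conj_fun w x)) \<le> e2ennreal \<bar>conjugate \<phi> (lin w x)\<bar>"
      by (cases "conjugate \<phi> (lin w x)") auto
  qed
  also have "\<dots> < \<infinity>" using fin by (simp add: less_top)
  finally show "integrable P (conj_fun w)" by (intro integrableI_bounded) auto
qed

lemma conj_integrable_dual_objective: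
  "w \<in> conj_integrable_set \<phi> P g \<Longrightarrow> dual_objective \<phi> P g w = ereal (fst w - (LINT x|P. conj_fun w x))"
  using dual_objective_real[OF conj_integrable(2,1)] .

text \<open>Moving \<open>w\<close> along the constant function \<open>g\<^sub>0 = 1\<close> shifts \<open>w\<^sup>T g x\<close> by a constant and stays in the
  ball, so the conjugate is finite on both sides of \<open>w\<^sup>T g x\<close>.\<close>
lemma psi_finite_in_ball:
  assumes e: "ball v e \<subseteq> conj_integrable_set \<phi> P g" and w: "w \<in> ball v e"
  shows "AE x in P. \<psi> (lin w x) = ereal (dens w x)"
proof -
  define \<delta> where "\<delta> = (e - dist v w) / 2"
  have \<delta>: "\<delta> > 0" "dist v w + \<delta> < e" using w by (auto simp: \<delta>_def field_simps)
  have shift: "w + r *\<^sub>R (1, 0) \<in> conj_integrable_set \<phi> P g" if "\<bar>r\<bar> = \<delta>" for r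
  proof -
    have "dist v (w + r *\<^sub>R (1, 0)) \<le> dist v w + dist w (w + r *\<^sub>R (1, 0))" by (rule dist_triangle)
    also have "\<dots> = dist v w + \<delta>" using that by (simp add: dist_norm norm_Pair)
    finally show ?thesis using e \<delta> by (auto simp: mem_ball)
  qed
  have lin: "lin (w + r *\<^sub>R (1, 0)) x = lin w x + r" for r x
    by (simp add: inner_add_left gvec_def)
  have fin: "AE x in P. conjugate \<phi> (lin z x) < \<infinity>" if "z \<in> conj_integrable_set \<phi> P g" for z
    using conj_integrable(1)[OF that]
  proof eventually_elim
    case (elim x)
    then show ?case by (cases "conjugate \<phi> (lin z x)") auto
  qed
  have "AE x in P. conjugate \<phi> (lin w x + \<delta>) < \<infinity>" "AE x in P. conjugate \<phi> (lin w x - \<delta>) < \<infinity>"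
    using fin[OF shift[of \<delta>]] fin[OF shift[of "- \<delta>"]] \<delta>(1) unfolding lin by simp_all
  then show ?thesis
  proof eventually_elim
    case (elim x)
    then have "\<bar>\<psi> (lin w x)\<bar> \<noteq> \<infinity>" by (rule psi_finite[OF \<delta>(1)])
    then show ?case
      unfolding dual_density_def dual_density_ext_def by (cases "\<psi> (lin w x)") auto
  qed
qed

text \<open>The difference quotients \<open>d r\<close> of the conjugate along \<open>u\<close> lie between the slope
  \<open>\<psi> (v\<^sup>T g) (u\<^sup>T g)\<close> at \<open>v\<close> and the slope at the shifted point, which converge to each other
  because \<open>\<psi>\<close> is continuous. Convexity bounds the quotients for small \<open>r > 0\<close> by the integrable
  \<open>d \<delta>\<close>, and the slope itself is caught between \<open>d (- \<delta>)\<close> and \<open>d \<delta>\<close>. Since \<open>v\<close> is optimal, the integral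
  of \<open>d r\<close> is at least \<open>u\<^sub>0\<close> for \<open>r > 0\<close>, and dominated convergence transfers this to the slope.\<close>
lemma directional_first_order_condition:
  assumes opt: "dual_optimal \<phi> P g v"
    and e: "e > 0" "ball v e \<subseteq> conj_integrable_set \<phi> P g"
  shows "integrable P (\<lambda>x. dens v x * lin u x)"
    and "fst u \<le> (LINT x|P. dens v x * lin u x)"
proof -
  define \<delta> where "\<delta> = e / (norm u + 1)"
  have pos: "norm u + 1 > 0" using norm_ge_zero[of u] by linarith
  then have "\<delta> > 0" "\<delta> * (norm u + 1) = e" using e(1) by (simp_all add: \<delta>_def)
  then have \<delta>: "\<delta> > 0" "\<delta> * norm u < e" by (simp_all add: distrib_left)
  have in_ball: "v + r *\<^sub>R u \<in> ball v e" if "\<bar>r\<bar> \<le> \<delta>" for r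
  proof -
    have "\<bar>r\<bar> * norm u \<le> \<delta> * norm u" using that by (intro mult_right_mono) auto
    then show ?thesis using \<delta> by (simp add: dist_norm)
  qed
  then have in_set: "v + r *\<^sub>R u \<in> conj_integrable_set \<phi> P g" if "\<bar>r\<bar> \<le> \<delta>" for r
    using e(2) that by blast
  have lin: "lin (v + r *\<^sub>R u) x = lin v x + r * lin u x" for r x
    by (simp add: inner_add_left)
  define s where "s n = \<delta> / real (Suc n)" for n
  have s: "0 < s n" "s n \<le> \<delta>" for n
    using \<delta> by (auto simp: s_def field_simps)
  define f where "f x = dens v x" for x
  define c where "c x = conj_fun v x" for x
  define d where "d r x = (conj_fun (v + r *\<^sub>R u) x - c x) / r" for r x
  have v_in: "v \<in> conj_integrable_set \<phi> P g" using in_set[of 0] \<delta> by simp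
  have int_c: "integrable P c" unfolding c_def using conj_integrable(2)[OF v_in] .
  have int_d: "integrable P (d r)" if "\<bar>r\<bar> \<le> \<delta>" for r
    unfolding d_def using conj_integrable(2)[OF in_set[OF that]] int_c by auto
  have f_psi: "AE x in P. \<psi> (lin v x) = ereal (f x)"
    unfolding f_def using psi_finite_in_ball[OF e(2), of v] e(1) by simp
  have f_meas [measurable]: "f \<in> borel_measurable P"
    unfolding f_def dual_density_def dual_density_ext_def by measurable
  have ae: "AE x in P. f x * lin u x \<le> d (s n) x \<and> d (- \<delta>) x \<le> f x * lin u x \<and> d (s n) x \<le> d \<delta> x \<and>
      d (s n) x \<le> dens (v + s n *\<^sub>R u) x * lin u x \<and>
      \<psi> (lin (v + s n *\<^sub>R u) x) = ereal (dens (v + s n *\<^sub>R u) x)" for n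
  proof -
    have "AE x in P. conjugate \<phi> (lin (v + r *\<^sub>R u) x) = ereal (conj_fun (v + r *\<^sub>R u) x)" if "\<bar>r\<bar> \<le> \<delta>" for r
      by (rule conj_integrable(1)[OF in_set[OF that]])
    moreover have "AE x in P. \<psi> (lin (v + r *\<^sub>R u) x) = ereal (dens (v + r *\<^sub>R u) x)" if "\<bar>r\<bar> \<le> \<delta>" for r
      by (rule psi_finite_in_ball[OF e(2) in_ball[OF that]])
    ultimately have A:
      "AE x in P. conjugate \<phi> (lin (v + r *\<^sub>R u) x) = ereal (conj_fun (v + r *\<^sub>R u) x) \<and>
        \<psi> (lin (v + r *\<^sub>R u) x) = ereal (dens (v + r *\<^sub>R u) x)" if "\<bar>r\<bar> \<le> \<delta>" for r
      using that by (intro AE_conjI) auto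
    have r: "\<bar>0\<bar> \<le> \<delta>" "\<bar>s n\<bar> \<le> \<delta>" "\<bar>\<delta>\<bar> \<le> \<delta>" "\<bar>- \<delta>\<bar> \<le> \<delta>" using \<delta> s[of n] by auto
    show ?thesis
      using A[OF r(1)] A[OF r(2)] A[OF r(3)] A[OF r(4)]
    proof eventually_elim
      case (elim x)
      let ?t = "lin v x" and ?r = "lin u x"
      let ?q = "dens (v + s n *\<^sub>R u) x"
      have p: "\<psi> ?t = ereal (f x)" "conjugate \<phi> ?t = ereal (c x)"
        using elim(1) by (auto simp: f_def c_def)
      have n: "\<psi> (?t + s n * ?r) = ereal ?q"
        "conjugate \<phi> (?t + s n * ?r) = ereal (conj_fun (v + s n *\<^sub>R u) x)"
        using elim(2) unfolding lin by auto
      have b: "conjugate \<phi> (?t + \<delta> * ?r) = ereal (conj_fun (v + \<delta> *\<^sub>R u) x)"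
        using elim(3) unfolding lin by auto
      have m: "\<psi> (?t + (- \<delta>) * ?r) = ereal (dens (v + (- \<delta>) *\<^sub>R u) x)"
        "conjugate \<phi> (?t + (- \<delta>) * ?r) = ereal (conj_fun (v + (- \<delta>) *\<^sub>R u) x)"
        using elim(4) unfolding lin by auto
      have "f x * (s n * ?r) \<le> conj_fun (v + s n *\<^sub>R u) x - c x"
        "conj_fun (v + s n *\<^sub>R u) x - c x \<le> ?q * (s n * ?r)"
        using conjugate_difference_bounds[OF p(1) n(1) p(2) n(2)] by simp_all
      then have 1: "f x * ?r \<le> d (s n) x" "d (s n) x \<le> ?q * ?r"
        using s(1)[of n] by (auto simp: d_def field_simps)
      have "f x * ((- \<delta>) * ?r) \<le> conj_fun (v + (- \<delta>) *\<^sub>R u) x - c x"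
        using conjugate_difference_bounds(1)[OF p(1) m(1) p(2) m(2)] by simp
      then have 2: "d (- \<delta>) x \<le> f x * ?r"
        using \<delta>(1) by (simp add: d_def field_simps)
      define \<theta> where "\<theta> = s n / \<delta>"
      have \<theta>: "0 \<le> \<theta>" "\<theta> \<le> 1" "s n = \<theta> * \<delta>" using s[of n] \<delta>(1) by (auto simp: \<theta>_def)
      have "?t + s n * ?r = (1 - \<theta>) * ?t + \<theta> * (?t + \<delta> * ?r)"
        using \<theta>(3) by (simp add: algebra_simps)
      then have "conj_fun (v + s n *\<^sub>R u) x \<le> (1 - \<theta>) * c x + \<theta> * conj_fun (v + \<delta> *\<^sub>R u) x"
        using conjugate_convex[OF p(2) b _ \<theta>(1,2)] n(2) by simp
      then have "conj_fun (v + s n *\<^sub>R u) x - c x \<le> \<theta> * (conj_fun (v + \<delta> *\<^sub>R u) x - c x)"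
        by (simp add: algebra_simps)
      also have "\<dots> = d \<delta> x * s n" using \<delta>(1) by (simp add: \<theta>(3) d_def)
      finally have 3: "d (s n) x \<le> d \<delta> x"
        using s(1)[of n] by (simp add: d_def[of "s n"] divide_le_eq)
      show ?case using 1 2 3 elim(2) by blast
    qed
  qed
  then have ae_all: "AE x in P. \<forall>n. f x * lin u x \<le> d (s n) x \<and> d (- \<delta>) x \<le> f x * lin u x \<and> d (s n) x \<le> d \<delta> x \<and>
      d (s n) x \<le> dens (v + s n *\<^sub>R u) x * lin u x \<and>
      \<psi> (lin (v + s n *\<^sub>R u) x) = ereal (dens (v + s n *\<^sub>R u) x)"
    by (simp add: AE_all_countable)
  have int_d': "integrable P (d \<delta>)" "integrable P (d (- \<delta>))" using \<delta>(1) int_d by auto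
  have int_f: "integrable P (\<lambda>x. f x * lin u x)"
  proof (rule Bochner_Integration.integrable_bound)
    show "integrable P (\<lambda>x. \<bar>d \<delta> x\<bar> + \<bar>d (- \<delta>) x\<bar>)" using int_d' by auto
    show "AE x in P. norm (f x * lin u x) \<le> norm (\<bar>d \<delta> x\<bar> + \<bar>d (- \<delta>) x\<bar>)"
      using ae[of 0] by eventually_elim (simp add: abs_if split: if_splits)
  qed measurable
  then show "integrable P (\<lambda>x. dens v x * lin u x)" by (simp add: f_def)
  have lim: "(\<lambda>n. LINT x|P. d (s n) x) \<longlonglongrightarrow> (LINT x|P. f x * lin u x)"
  proof (rule integral_dominated_convergence)
    show "integrable P (\<lambda>x. \<bar>f x * lin u x\<bar> + \<bar>d \<delta> x\<bar>)" using int_f int_d' by auto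
    show "AE x in P. norm (d (s n) x) \<le> \<bar>f x * lin u x\<bar> + \<bar>d \<delta> x\<bar>" for n
      using ae[of n] by eventually_elim (auto simp: abs_if)
    show "AE x in P. (\<lambda>n. d (s n) x) \<longlonglongrightarrow> f x * lin u x"
      using ae_all f_psi
    proof eventually_elim
      case (elim x)
      let ?q = "\<lambda>n. dens (v + s n *\<^sub>R u) x"
      have "s \<longlonglongrightarrow> 0" unfolding s_def by (rule LIMSEQ_Suc[OF lim_const_over_n])
      then have "(\<lambda>n. lin v x + s n * lin u x) \<longlonglongrightarrow> lin v x + 0 * lin u x"
        by (intro tendsto_intros)
      then have "(\<lambda>n. \<psi> (lin v x + s n * lin u x)) \<longlonglongrightarrow> \<psi> (lin v x)"
        using isCont_tendsto_compose[OF isCont_psi] by simp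
      moreover have "\<psi> (lin v x + s n * lin u x) = ereal (?q n)" for n using elim(1) by (simp add: lin)
      moreover have "\<psi> (lin v x) = ereal (f x)" using elim(2) .
      ultimately have "?q \<longlonglongrightarrow> f x" by (simp add: lim_ereal)
      then have upper: "(\<lambda>n. ?q n * lin u x) \<longlonglongrightarrow> f x * lin u x" by (intro tendsto_intros)
      have "f x * lin u x \<le> d (s n) x" "d (s n) x \<le> ?q n * lin u x" for n
        using elim(1) by blast+
      then show ?case
        by (intro tendsto_sandwich[OF _ _ tendsto_const upper] always_eventually allI)
    qed
    show "(\<lambda>x. f x * lin u x) \<in> borel_measurable P" by measurable
    show "d (s n) \<in> borel_measurable P" for n
      using int_d[of "s n"] s[of n] by auto
  qed
  have "fst u \<le> (LINT x|P. d (s n) x)" for n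
  proof -
    let ?w = "v + s n *\<^sub>R u"
    have sn: "\<bar>s n\<bar> \<le> \<delta>" using s[of n] by simp
    have "dual_objective \<phi> P g ?w \<le> dual_objective \<phi> P g v"
      using opt by (simp add: dual_optimal_def SUP_upper)
    then have "fst ?w - (LINT x|P. conj_fun ?w x) \<le> fst v - (LINT x|P. c x)"
      unfolding conj_integrable_dual_objective[OF in_set[OF sn]] conj_integrable_dual_objective[OF v_in]
      by (simp add: c_def)
    then have "s n * fst u \<le> (LINT x|P. conj_fun ?w x) - (LINT x|P. c x)" by simp
    also have "\<dots> = s n * (LINT x|P. d (s n) x)"
      using conj_integrable(2)[OF in_set[OF sn]] int_c s(1)[of n] by (simp add: d_def)
    finally show ?thesis using s(1)[of n] by simp
  qed
  then have "fst u \<le> (LINT x|P. f x * lin u x)"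
    by (intro LIMSEQ_le_const[OF lim] exI[of _ 0] allI impI)
  then show "fst u \<le> (LINT x|P. dens v x * lin u x)" by (simp only: f_def)
qed

text \<open>The inequality for \<open>u\<close> and for \<open>- u\<close> gives the moment equation in the direction \<open>u\<close>. The divergence is
  finite by the equality case of the Young inequality, as \<open>\<psi> (v\<^sup>T g) (v\<^sup>T g)\<close> and the conjugate
  are both integrable.\<close>
lemma interior_dual_optimal_moment_condition:
  assumes opt: "dual_optimal \<phi> P g v" and v: "v \<in> interior (conj_integrable_set \<phi> P g)"
  shows "moment_condition \<phi> P g v"
proof -
  obtain e where e: "e > 0" "ball v e \<subseteq> conj_integrable_set \<phi> P g"
    using v by (auto simp: mem_interior)
  let ?f = "dens v"
  note foc = directional_first_order_condition[OF opt e]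
  have int: "integrable P (\<lambda>x. ?f x *\<^sub>R gvec g x)" using foc(1) integrable_gvec_iff by blast
  have eq: "(LINT x|P. ?f x * lin u x) = fst u" for u
    using foc(2)[of u] foc(2)[of "- u"] by simp
  have "inner u (LINT x|P. ?f x *\<^sub>R gvec g x) = inner u (1, 0)" for u
  proof -
    have "inner u (LINT x|P. ?f x *\<^sub>R gvec g x) = (LINT x|P. inner u (?f x *\<^sub>R gvec g x))"
      using int by (intro integral_inner_right[symmetric]) auto
    also have "\<dots> = (LINT x|P. ?f x * lin u x)" by simp
    also have "\<dots> = inner u (1, 0)" unfolding eq by (simp add: inner_prod_def)
    finally show ?thesis .
  qed
  then have mom: "(LINT x|P. ?f x *\<^sub>R gvec g x) = (1, 0)" by (rule vector_eq_ldot[THEN iffD1, OF allI])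
  have ae: "AE x in P. \<psi> (lin v x) = ereal (?f x)" using psi_finite_in_ball[OF e(2), of v] e(1) by simp
  have v_in: "v \<in> conj_integrable_set \<phi> P g" using e by auto
  have "AE x in P. \<phi> (?f x) = ennreal (?f x * lin v x - conj_fun v x)"
    using ae
  proof eventually_elim
    case (elim x)
    then show ?case unfolding psi_eq_iff using phi_eq[of "?f x"] by (simp add: mult.commute)
  qed
  then have "(\<integral>\<^sup>+ x. \<phi> (?f x) \<partial>P) = (\<integral>\<^sup>+ x. ennreal (?f x * lin v x - conj_fun v x) \<partial>P)"
    by (rule nn_integral_cong_AE)
  also have "\<dots> < \<infinity>"
  proof -
    have "integrable P (\<lambda>x. ?f x * lin v x - conj_fun v x)"
      using foc(1)[of v] conj_integrable(2)[OF v_in] by simp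
    then have "(\<integral>\<^sup>+ x. ennreal (?f x * lin v x - conj_fun v x) \<partial>P) \<noteq> \<infinity>"
      unfolding real_integrable_def by blast
    then show ?thesis using top.not_eq_extremum infinity_ennreal_def by metis
  qed
  finally have "feasible ?f" using int mom by (simp add: feasible_def)
  then show ?thesis using ae by (simp add: moment_condition_iff)
qed

end

section \<open>The duality theorem\<close>

theorem corollary5p3:
  fixes P :: "'a measure"
    and \<phi> :: "real \<Rightarrow> ennreal"
    and g :: "'l::finite \<Rightarrow> 'a \<Rightarrow> real"
  assumes "prob_space P"
    and "divergence_function \<phi>"
    and "\<And>i. g i \<in> borel_measurable P"
    and "lin_indep P g"
    and "differentiable_fun \<phi>"
    and "strictly_convex_fun \<phi>"
  shows "(\<forall>v. moment_condition \<phi> P g v \<longrightarrow>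
           (is_projection \<phi> P (constraint_set P g) (signed_density P (dual_density \<phi> g v)) \<and>
            (\<forall>Q. is_projection \<phi> P (constraint_set P g) Q \<longrightarrow>
                 Q = signed_density P (dual_density \<phi> g v))) \<and>
           ((INF Q \<in> constraint_set P g. enn2ereal (divergence \<phi> P Q)) =
              (SUP w. dual_objective \<phi> P g w) \<and>
            dual_optimal \<phi> P g v \<and>
            (essentially_smooth \<phi> \<longrightarrow> (\<forall>w. dual_optimal \<phi> P g w \<longrightarrow> w = v)))) \<and>
         (\<forall>v. dual_optimal \<phi> P g v \<and> v \<in> interior (conj_integrable_set \<phi> P g) \<longrightarrow>
              moment_condition \<phi> P g v)"
proof -
  interpret prob_space P by fact
  interpret dual_problem \<phi> P g
    using assms by unfold_locales auto
  show ?thesis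
  proof (intro conjI allI impI; (elim conjE)?)
    fix v assume mc: "moment_condition \<phi> P g v"
    show "is_projection \<phi> P (constraint_set P g) (signed_density P (dual_density \<phi> g v))"
      by (rule moment_density_is_projection[OF mc])
    show "Q = signed_density P (dual_density \<phi> g v)"
      if "is_projection \<phi> P (constraint_set P g) Q" for Q
      by (rule projection_unique[OF mc that])
    show "(INF Q \<in> constraint_set P g. enn2ereal (divergence \<phi> P Q)) = (SUP w. dual_objective \<phi> P g w)"
      unfolding primal_value[OF mc] dual_sup[OF mc] ..
    show "dual_optimal \<phi> P g v"
      unfolding dual_optimal_def dual_value[OF mc] dual_sup[OF mc] ..
    show "w = v" if "essentially_smooth \<phi>" "dual_optimal \<phi> P g w" for w
      by (rule dual_unique[OF mc assms(4) that])
  next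
    fix v assume "dual_optimal \<phi> P g v" "v \<in> interior (conj_integrable_set \<phi> P g)"
    then show "moment_condition \<phi> P g v" by (rule interior_dual_optimal_moment_condition)
  qed
qed

end
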